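(* Let $X$ and $Y$ be complex infinite-dimensional Banach spaces, $A\in B(X)$, $B\in B(Y)$, $C\in B(Y,X)$, and let $M_C=\begin{pmatrix}A&C\\0&B\end{pmatrix}\in B(X\oplus Y)$. If $\sigma_*$ is any one of $\sigma_{lD},\sigma_{rD},\sigma_{lr},\sigma_{K_3},\sigma_K,\sigma_{SF_0}$, then $\sigma_*$ has the convex filling-in-hole property, that is, $$\eta\bigl(\sigma_*(A)\cup\sigma_*(B)\bigr)=\eta\bigl(\sigma_*(M_C)\bigr).$$
   Context: $B(Y,X)$ is the set of bounded linear operators from $Y$ to $X$, and $B(X)=B(X,X)$. For a compact $M\subset\mathbb{C}$, $\eta(M)=\{w\in\mathbb{C}:|P(w)|\le\max\{|P(z)|:z\in M\}\text{ for every polynomial }P\}$ is the polynomially convex hull of $M$, with the convention $\eta(\emptyset)=\emptyset$. For $T\in B(X)$ let $\alpha(T)=\dim N(T)$ and $\beta(T)=\dim X/R(T)$, where $N(T)$ and $R(T)$ are the kernel and range. The ascent $asc(T)$ is the smallest nonnegative integer $k$ with $N(T^k)=N(T^{k+1})$ and the descent $des(T)$ is the smallest nonnegative integer $k$ with $R(T^k)=R(T^{k+1})$ (each is $\infty$ if no such $k$ exists). Operator classes: $\Phi_+(X)=\{T:\alpha(T)<\infty\text{ and }R(T)\text{ is closed}\}$; $\Phi_-(X)=\{T:\beta(T)<\infty\}$; $\Phi_l(X)=\{T: R(T)\text{ is a closed and complemented subspace of }X\text{ and }\alpha(T)<\infty\}$; $\Phi_r(X)=\{T: N(T)\text{ is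 a closed and complemented subspace of }X\text{ and }\beta(T)<\infty\}$; $R_4(X)=\{T: des(T)<\infty,\ R(T^{des(T)})\text{ is closed}\}$; $R_9(X)=\{T: asc(T)<\infty,\ R(T^{asc(T)+1})\text{ is closed}\}$; $SF_0(X)=\{T\in\Phi_+(X)\cup\Phi_-(X):\alpha(T)=0\text{ or }\beta(T)=0\}$. Spectra ($\lambda$ ranging over $\mathbb{C}$): $\sigma_{rD}(T)=\{\lambda:T-\lambda I\notin R_4(X)\}$; $\sigma_{lD}(T)=\{\lambda:T-\lambda I\notin R_9(X)\}$; $\sigma_{lr}(T)=\{\lambda:T-\lambda I\text{ is neither left nor right invertible in }B(X)\}$; $\sigma_K(T)=\{\lambda:T-\lambda I\notin\Phi_+(X)\cup\Phi_-(X)\}$; $\sigma_{K_3}(T)=\{\lambda:T-\lambda I\notin\Phi_l(X)\cup\Phi_r(X)\}$; $\sigma_{SF_0}(T)=\{\lambda:T-\lambda I\notin SF_0(X)\}$. The same definitions apply on $Y$ and $X\oplus Y$. *)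

theory Defs
  imports "HOL-Analysis.Analysis" "HOL-Computational_Algebra.Polynomial" "HOL-Library.Extended_Nat"
begin

class complex_banach = banach +
  fixes scaleC :: "complex \<Rightarrow> 'a \<Rightarrow> 'a" (infixr "*\<^sub>C" 75)
  assumes scaleC_add_right: "c *\<^sub>C (x + y) = c *\<^sub>C x + c *\<^sub>C y"
    and scaleC_add_left: "(c + d) *\<^sub>C x = c *\<^sub>C x + d *\<^sub>C x"
    and scaleC_scaleC: "c *\<^sub>C (d *\<^sub>C x) = (c * d) *\<^sub>C x"
    and scaleC_one: "1 *\<^sub>C x = x"
    and scaleR_scaleC: "r *\<^sub>R x = complex_of_real r *\<^sub>C x"
    and norm_scaleC: "norm (c *\<^sub>C x) = cmod c * norm x"

interpretation complex_vector: vector_space "scaleC :: complex \<Rightarrow> 'a \<Rightarrow> 'a::complex_banach"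
  by unfold_locales
    (simp_all add: scaleC_add_right scaleC_add_left scaleC_scaleC scaleC_one)

instantiation prod :: (complex_banach, complex_banach) complex_banach
begin

definition scaleC_prod :: "complex \<Rightarrow> 'a \<times> 'b \<Rightarrow> 'a \<times> 'b"
  where "scaleC_prod c p = (c *\<^sub>C fst p, c *\<^sub>C snd p)"

instance
proof
  fix c :: complex and p :: "'a \<times> 'b"
  have "norm (c *\<^sub>C p) = sqrt ((cmod c)\<^sup>2 * ((norm (fst p))\<^sup>2 + (norm (snd p))\<^sup>2))"
    by (simp add: scaleC_prod_def norm_prod_def norm_scaleC power_mult_distrib distrib_left)
  then show "norm (c *\<^sub>C p) = cmod c * norm p"
    by (simp add: norm_prod_def real_sqrt_mult)
qed (simp_all add: scaleC_prod_def scaleC_add_right scaleC_add_left scaleC_scaleC scaleC_one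
      scaleR_prod_def scaleR_scaleC)

end

text \<open>The set \<open>B(Y,X)\<close> of bounded (complex-)linear operators from \<open>Y\<close> to \<open>X\<close>.\<close>

definition bounded_ops :: "('a::complex_banach \<Rightarrow> 'b::complex_banach) set"
  where "bounded_ops = {T. bounded_linear T \<and> (\<forall>c x. T (c *\<^sub>C x) = c *\<^sub>C T x)}"

definition upper_triangular ::
  "('x::complex_banach \<Rightarrow> 'x) \<Rightarrow> ('y::complex_banach \<Rightarrow> 'x) \<Rightarrow> ('y \<Rightarrow> 'y) \<Rightarrow> 'x \<times> 'y \<Rightarrow> 'x \<times> 'y"
  where "upper_triangular A C B = (\<lambda>(x, y). (A x + C y, B y))"

text \<open>Dimensions are complex dimensions with values in \<open>enat\<close>; all infinite cardinals are
  identified with \<open>\<infinity>\<close>. (The library's \<open>dim\<close> is only meaningful for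
  finite-dimensional subspaces.)\<close>

definition finite_dim :: "'a::complex_banach set \<Rightarrow> bool"
  where "finite_dim S \<longleftrightarrow> (\<exists>F. finite F \<and> S \<subseteq> complex_vector.span F)"

definition edim :: "'a::complex_banach set \<Rightarrow> enat"
  where "edim S = (if finite_dim S then enat (complex_vector.dim S) else \<infinity>)"

text \<open>A finite set \<open>F\<close> satisfies \<open>independent_mod M F\<close> if the cosets \<open>b + M\<close>
  (\<open>b \<in> F\<close>) are distinct and linearly independent in the quotient space \<open>X/M\<close>; the premise
  says that the combination of these cosets with coefficients \<open>c\<close> is the zero of \<open>X/M\<close>.
  The dimension of \<open>X/M\<close> is the supremum of the sizes of finite independent subsets.\<close>

definition independent_mod :: "'a::complex_banach set \<Rightarrow> 'a set \<Rightarrow> bool"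
  where "independent_mod M F \<longleftrightarrow>
    (\<forall>c :: 'a \<Rightarrow> complex. (\<Sum>b\<in>F. c b *\<^sub>C b) \<in> M \<longrightarrow> (\<forall>b\<in>F. c b = 0))"

definition quotient_dim :: "'a::complex_banach set \<Rightarrow> enat"
  where "quotient_dim M = (SUP F\<in>{F. finite F \<and> independent_mod M F}. enat (card F))"

definition kernel :: "('a::complex_banach \<Rightarrow> 'b::complex_banach) \<Rightarrow> 'a set"
  where "kernel T = {x. T x = 0}"

definition nullity :: "('a::complex_banach \<Rightarrow> 'a) \<Rightarrow> enat"
  where "nullity T = edim (kernel T)"

definition deficiency :: "('a::complex_banach \<Rightarrow> 'a) \<Rightarrow> enat"
  where "deficiency T = quotient_dim (range T)"

definition ascent :: "('a::complex_banach \<Rightarrow> 'a) \<Rightarrow> enat"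
  where "ascent T =
    (if \<exists>k. kernel (T ^^ k) = kernel (T ^^ (k + 1))
     then enat (LEAST k. kernel (T ^^ k) = kernel (T ^^ (k + 1))) else \<infinity>)"

definition descent :: "('a::complex_banach \<Rightarrow> 'a) \<Rightarrow> enat"
  where "descent T =
    (if \<exists>k. range (T ^^ k) = range (T ^^ (k + 1))
     then enat (LEAST k. range (T ^^ k) = range (T ^^ (k + 1))) else \<infinity>)"

text \<open>Complementation is topological: the complement must itself be a closed subspace.\<close>

definition closed_complemented :: "'a::complex_banach set \<Rightarrow> bool"
  where "closed_complemented M \<longleftrightarrow>
    closed M \<and> complex_vector.subspace M \<and>
    (\<exists>W. closed W \<and> complex_vector.subspace W \<and> M \<inter> W = {0} \<and> {u + v |u v. u \<in> M \<and> v \<in> W} = UNIV)"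

definition Phi_plus :: "('a::complex_banach \<Rightarrow> 'a) set"
  where "Phi_plus = {T \<in> bounded_ops. nullity T < \<infinity> \<and> closed (range T)}"

definition Phi_minus :: "('a::complex_banach \<Rightarrow> 'a) set"
  where "Phi_minus = {T \<in> bounded_ops. deficiency T < \<infinity>}"

definition Phi_l :: "('a::complex_banach \<Rightarrow> 'a) set"
  where "Phi_l = {T \<in> bounded_ops. closed_complemented (range T) \<and> nullity T < \<infinity>}"

definition Phi_r :: "('a::complex_banach \<Rightarrow> 'a) set"
  where "Phi_r = {T \<in> bounded_ops. closed_complemented (kernel T) \<and> deficiency T < \<infinity>}"

definition R4 :: "('a::complex_banach \<Rightarrow> 'a) set"
  where "R4 = {T \<in> bounded_ops. descent T < \<infinity> \<and> closed (range (T ^^ the_enat (descent T)))}"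

definition R9 :: "('a::complex_banach \<Rightarrow> 'a) set"
  where "R9 = {T \<in> bounded_ops. ascent T < \<infinity> \<and> closed (range (T ^^ (the_enat (ascent T) + 1)))}"

definition SF0 :: "('a::complex_banach \<Rightarrow> 'a) set"
  where "SF0 = {T \<in> Phi_plus \<union> Phi_minus. nullity T = 0 \<or> deficiency T = 0}"

definition left_invertible :: "('a::complex_banach \<Rightarrow> 'a) \<Rightarrow> bool"
  where "left_invertible T \<longleftrightarrow> (\<exists>S\<in>bounded_ops. S \<circ> T = id)"

definition right_invertible :: "('a::complex_banach \<Rightarrow> 'a) \<Rightarrow> bool"
  where "right_invertible T \<longleftrightarrow> (\<exists>S\<in>bounded_ops. T \<circ> S = id)"

definition shift_op :: "('a::complex_banach \<Rightarrow> 'a) \<Rightarrow> complex \<Rightarrow> 'a \<Rightarrow> 'a"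
  where "shift_op T l = (\<lambda>x. T x - l *\<^sub>C x)"

definition sigma_rD :: "('a::complex_banach \<Rightarrow> 'a) \<Rightarrow> complex set"
  where "sigma_rD T = {l. shift_op T l \<notin> R4}"

definition sigma_lD :: "('a::complex_banach \<Rightarrow> 'a) \<Rightarrow> complex set"
  where "sigma_lD T = {l. shift_op T l \<notin> R9}"

definition sigma_lr :: "('a::complex_banach \<Rightarrow> 'a) \<Rightarrow> complex set"
  where "sigma_lr T = {l. \<not> left_invertible (shift_op T l) \<and> \<not> right_invertible (shift_op T l)}"

definition sigma_K :: "('a::complex_banach \<Rightarrow> 'a) \<Rightarrow> complex set"
  where "sigma_K T = {l. shift_op T l \<notin> Phi_plus \<union> Phi_minus}"

definition sigma_K3 :: "('a::complex_banach \<Rightarrow> 'a) \<Rightarrow> complex set"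
  where "sigma_K3 T = {l. shift_op T l \<notin> Phi_l \<union> Phi_r}"

definition sigma_SF0 :: "('a::complex_banach \<Rightarrow> 'a) \<Rightarrow> complex set"
  where "sigma_SF0 T = {l. shift_op T l \<notin> SF0}"

text \<open>Polynomially convex hull. Intended for compact \<open>M\<close>, where for nonempty \<open>M\<close> the supremum
  is attained and hence is the maximum; the supremum of the empty set is unspecified, so the
  convention for \<open>M = {}\<close> is explicit.\<close>

definition poly_hull :: "complex set \<Rightarrow> complex set"
  where "poly_hull M = (if M = {} then {}
    else {w. \<forall>P :: complex poly. cmod (poly P w) \<le> (SUP z\<in>M. cmod (poly P z))})"

end

theory Submission
  imports Defs "HOL-Complex_Analysis.Conformal_Mappings"
begin

text \<open>
By the maximum modulus principle only the outer region, the unbounded component of the complement of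
the closure, matters for a polynomial hull (\<open>poly_hull_subset_if_outer\<close>). Over the outer region each
of the six regularity conditions turns into a two-sided one, and for the two-sided conditions the
triangular operator \<open>M\<close> can be compared with its diagonal entries \<open>A\<close> and \<open>B\<close>.

The outer region contains resolvent points. Call \<open>T\<close> Drazin invertible if its ascent and descent are
finite; then \<open>T - m\<close> is bijective for all small \<open>m \<noteq> 0\<close> (\<open>drazin_punctured_disc\<close>). The crucial
converse is that an operator that satisfies one of the one-sided regularity conditions (finite
ascent or descent with closed range, upper or lower semi-Fredholm) and is a limit of bijective
operators \<open>T - m\<close>, with \<open>m\<close> tending to 0, is Drazin invertible (\<open>admissible_imp_drazin\<close>). The reason
is that kernel vectors of a surjection persist under small shifts, so bijectivity at nearby points
forces injectivity on an invariant subspace onto which \<open>T\<close> maps; dually, a lower bound together with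
bijectivity at nearby points forces surjectivity. Consequently the points \<open>l\<close> of the outer region at which
\<open>T - l\<close> is Drazin invertible form a relatively open and closed set, and Drazin invertibility
propagates from infinity to the whole region (\<open>drazin_propagates\<close>).

Among Drazin invertible operators the six classes collapse to three: the two Drazin classes contain
all of them, \<open>SF0\<close> and one-sided invertibility mean invertibility, and the Fredholm-type classes
mean that the kernel is finite-dimensional. For these three properties the triangular operator has
the property if the diagonal entries do (\<open>drazin_triangular\<close>, \<open>bij_triangular\<close>,
\<open>finite_kernel_triangular\<close>). In the opposite direction, Drazin invertibility of \<open>M\<close> passes to \<open>A\<close>
and \<open>B\<close> at limits of points where both are bijective (\<open>drazin_diagonal\<close>), so it again propagates
from infinity.
\<close>

section \<open>Polynomial hulls and outer regions\<close>

text \<open>Only the outer region matters for polynomial hulls. A point of \<open>K1\<close> outside the closure of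
\<open>K2\<close> lies in a component of the complement of that closure. If the component is unbounded, it
contains a neighbourhood of infinity and is excluded by the last assumption; if it is bounded, its
frontier lies in the closure of \<open>K2\<close>, where the supremum over \<open>K2\<close> is still a bound, and the
maximum modulus principle applies. For empty \<open>K2\<close> the whole plane is an admissible \<open>V\<close>.\<close>

lemma poly_hull_subset_if_outer:
  assumes bd1: "bounded K1" and bd2: "bounded K2"
    and esc: "\<And>V R. \<lbrakk>open V; connected V; V \<inter> K2 = {}; {z. R < cmod z} \<subseteq> V\<rbrakk> \<Longrightarrow> V \<inter> K1 = {}"
  shows "poly_hull K1 \<subseteq> poly_hull K2"
proof (cases "K1 = {} \<or> K2 = {}")
  case True
  moreover have "K1 = {}" if "K2 = {}"
    using esc[of UNIV 0] that by auto
  ultimately show ?thesis by (auto simp: poly_hull_def)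
next
  case False
  have dom: "cmod (poly P z) \<le> (SUP u\<in>K2. cmod (poly P u))" if z: "z \<in> K1" for P z
  proof -
    define S where "S = (SUP u\<in>K2. cmod (poly P u))"
    have "compact ((\<lambda>u. cmod (poly P u)) ` closure K2)"
      using bd2 by (intro compact_continuous_image continuous_intros) (simp add: compact_closure)
    hence "bdd_above ((\<lambda>u. cmod (poly P u)) ` K2)"
      by (meson bounded_imp_bdd_above compact_imp_bounded bdd_above_mono closure_subset image_mono)
    hence "K2 \<subseteq> {u. cmod (poly P u) \<le> S}"
      unfolding S_def by (auto intro: cSUP_upper)
    moreover have "closed {u. cmod (poly P u) \<le> S}"
      by (intro closed_Collect_le continuous_intros)
    ultimately have clS: "closure K2 \<subseteq> {u. cmod (poly P u) \<le> S}"
      by (rule closure_minimal)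
    show ?thesis
    proof (cases "z \<in> closure K2")
      case True
      thus ?thesis using clS by (auto simp: S_def)
    next
      case zn: False
      define U where "U = connected_component_set (- closure K2) z"
      have oU: "open U"
        unfolding U_def by (intro open_connected_component) auto
      have zU: "z \<in> U"
        unfolding U_def using zn by simp
      have Usub: "U \<subseteq> - closure K2"
        unfolding U_def by (rule connected_component_subset)
      have "bounded U"
      proof (rule ccontr)
        assume unb: "\<not> bounded U"
        obtain R where R: "closure K2 \<subseteq> cball 0 R"
          using bounded_closure[OF bd2] by (auto simp: bounded_iff subset_iff)
        obtain u where u: "u \<in> U" "u \<notin> cball 0 R"
          using unb by (meson bounded_cball bounded_subset subsetI)
        have "connected (- cball 0 R :: complex set)"
          by (rule connected_complement_bounded_convex) auto
        moreover have "connected_component_set (- closure K2) u = U"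
          using u(1) connected_component_eq unfolding U_def by blast
        ultimately have "- cball 0 R \<subseteq> U"
          using connected_component_maximal[of u "- cball 0 R" "- closure K2"] u(2) R by blast
        hence "{v. R < cmod v} \<subseteq> U"
          by (auto simp: subset_iff not_le)
        moreover have "connected U" "U \<inter> K2 = {}"
          using Usub closure_subset[of K2] unfolding U_def by auto
        ultimately show False
          using esc[OF oU, of R] z zU by auto
      qed
      moreover have "frontier U \<subseteq> closure K2"
        using frontier_of_connected_component_subset[of "- closure K2" z]
          frontier_subset_closed[of "closure K2"]
        unfolding U_def frontier_complement by blast
      ultimately have "cmod (poly P u) \<le> S" if "u \<in> frontier U" for u
        using that clS by auto
      hence "cmod (poly P z) \<le> S"
        using \<open>bounded U\<close> zU oU
        by (intro maximum_modulus_frontier[of "poly P" U S z])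
          (auto intro!: holomorphic_intros continuous_intros simp: interior_open)
      thus ?thesis by (simp add: S_def)
    qed
  qed
  have "cmod (poly P w) \<le> (SUP u\<in>K2. cmod (poly P u))"
    if "cmod (poly P w) \<le> (SUP u\<in>K1. cmod (poly P u))" for P w
    using that cSUP_least[of K1 "\<lambda>u. cmod (poly P u)", OF _ dom] False by force
  thus ?thesis
    using False by (auto simp: poly_hull_def)
qed

section \<open>Open mappings and perturbed surjections\<close>

lemma bounded_opsD:
  assumes "T \<in> bounded_ops"
  shows "bounded_linear T" "T (c *\<^sub>C x) = c *\<^sub>C T x" "T (x + y) = T x + T y"
    "T (x - y) = T x - T y" "T 0 = 0" "T (- x) = - T x"
  using assms unfolding bounded_ops_def
  by (auto simp: linear_simps bounded_linear.linear linear_0)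

lemma bounded_linear_scaleC: "bounded_linear (\<lambda>x :: 'a::complex_banach. c *\<^sub>C x)"
  by (rule bounded_linear_intro[where K = "cmod c"])
     (simp_all add: scaleC_add_right scaleR_scaleC scaleC_scaleC norm_scaleC mult.commute)

lemma bounded_linear_scaleC_left: "bounded_linear (\<lambda>c. c *\<^sub>C (x :: 'a::complex_banach))"
  by (rule bounded_linear_intro[where K = "norm x"])
     (simp_all add: scaleC_add_left scaleR_scaleC scaleC_scaleC norm_scaleC scaleR_conv_of_real)

lemma complex_subspace_imp_subspace:
  "complex_vector.subspace S \<Longrightarrow> subspace S"
  by (auto simp: subspace_def complex_vector.subspace_def scaleR_scaleC)

text \<open>The geometric iteration behind both the open mapping theorem and the stability of surjections: the
error is halved at each step, and the corrections form an absolutely convergent series in \<open>E\<close>.\<close>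

lemma exact_solution_of_approximate:
  fixes f :: "'a::banach \<Rightarrow> 'b::real_normed_vector"
  assumes f: "bounded_linear f" and E: "closed E" "subspace E"
    and F: "subspace F" "f ` E \<subseteq> F" and K0: "K \<ge> 0"
    and approx: "\<And>y. y \<in> F \<Longrightarrow> \<exists>x\<in>E. norm x \<le> K * norm y \<and> norm (y - f x) \<le> norm y / 2"
    and y: "y \<in> F"
  shows "\<exists>x\<in>E. f x = y \<and> norm x \<le> 2 * K * norm y"
proof -
  interpret bounded_linear f by fact
  obtain g where g: "\<And>y. y \<in> F \<Longrightarrow> g y \<in> E"
      "\<And>y. y \<in> F \<Longrightarrow> norm (g y) \<le> K * norm y"
      "\<And>y. y \<in> F \<Longrightarrow> norm (y - f (g y)) \<le> norm y / 2"
    using approx by metis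
  define Y where "Y = rec_nat y (\<lambda>_ z. z - f (g z))"
  have Y0: "Y 0 = y" and YS: "Y (Suc i) = Y i - f (g (Y i))" for i
    by (simp_all add: Y_def)
  have YF: "Y i \<in> F" for i
    by (induction i) (use F g(1) y in \<open>auto simp: Y0 YS intro!: subspace_diff\<close>)
  have Yn: "norm (Y i) \<le> norm y * (1/2) ^ i" for i
  proof (induction i)
    case (Suc i)
    thus ?case using g(3)[OF YF[of i]] by (simp add: YS)
  qed (simp add: Y0)
  define x where "x i = g (Y i)" for i
  have xb: "norm (x i) \<le> K * norm y * (1/2) ^ i" for i
    using g(2)[OF YF[of i]] mult_left_mono[OF Yn K0, of i] by (simp add: x_def mult.assoc)
  have sg: "summable (\<lambda>i. K * norm y * (1/2) ^ i)"
    by (intro summable_mult summable_geometric) simp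
  have sx: "summable x" by (rule summable_comparison_test'[OF sg, of 0]) (use xb in auto)
  have "norm (suminf x) \<le> (\<Sum>i. K * norm y * (1/2) ^ i)"
    by (rule norm_suminf_le[OF xb sg])
  also have "\<dots> = 2 * K * norm y"
    by (subst suminf_mult) (auto simp: suminf_geometric summable_geometric)
  finally have "norm (suminf x) \<le> 2 * K * norm y" .
  moreover have "suminf x \<in> E"
  proof (rule closed_sequentially[OF E(1)])
    show "(\<lambda>m. \<Sum>i<m. x i) \<longlonglongrightarrow> suminf x" using sx by (rule summable_LIMSEQ)
    show "(\<Sum>i<m. x i) \<in> E" for m
      by (intro subspace_sum E) (simp add: x_def g(1) YF)
  qed
  moreover have "f (suminf x) = y"
  proof -
    have "(\<lambda>i. f (x i)) sums f (suminf x)"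
      by (intro sums summable_sums sx)
    moreover have "(\<lambda>i. norm y * (1/2) ^ i) \<longlonglongrightarrow> norm y * 0"
      by (intro tendsto_mult tendsto_const LIMSEQ_power_zero) simp
    hence "Y \<longlonglongrightarrow> 0"
      by (intro Lim_null_comparison[of Y "\<lambda>i. norm y * (1/2) ^ i"]) (auto simp: Yn)
    hence "(\<lambda>i. Y i - Y (Suc i)) sums (Y 0 - 0)" by (rule telescope_sums')
    hence "(\<lambda>i. f (x i)) sums y" by (simp add: YS x_def Y0)
    ultimately show ?thesis using sums_unique2 by blast
  qed
  ultimately show ?thesis by blast
qed

text \<open>Banach's open mapping theorem for a restriction to a closed subspace. It is needed in this relative
form because it is applied to operators restricted to ranges of powers and to products with closed
subspaces, which are not types. Baire's theorem in the complete space \<open>f ` E\<close> provides a ball in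
the closure of the image of some ball, hence approximate solutions with a norm bound.\<close>

lemma open_mapping_bound:
  fixes f :: "'a::banach \<Rightarrow> 'b::banach"
  assumes f: "bounded_linear f" and E: "closed E" "subspace E" and fE: "closed (f ` E)"
  obtains k where "k > 0" "\<And>y. y \<in> f ` E \<Longrightarrow> \<exists>x\<in>E. f x = y \<and> norm x \<le> k * norm y"
proof -
  interpret bounded_linear f by fact
  define F where "F = f ` E"
  have sF: "subspace F"
    unfolding F_def by (rule linear_subspace_image[OF linear E(2)])
  define C where "C n = closure (f ` (E \<inter> cball 0 (real n)))" for n
  have CF: "C n \<subseteq> F" for n
    unfolding C_def F_def using fE by (intro closure_minimal) auto
  have cover: "F \<subseteq> (\<Union>n. C n)"
  proof
    fix y assume "y \<in> F"
    then obtain x where "x \<in> E" "y = f x" by (auto simp: F_def)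
    moreover obtain n where "norm x \<le> real n" using real_arch_simple by blast
    ultimately have "y \<in> f ` (E \<inter> cball 0 (real n))" by auto
    hence "y \<in> C n" unfolding C_def by (rule subsetD[OF closure_subset])
    thus "y \<in> (\<Union>n. C n)" by (rule UN_I[OF UNIV_I])
  qed
  have "\<exists>n. top_of_set F interior_of C n \<noteq> {}"
  proof (rule ccontr)
    assume "\<not> ?thesis"
    hence "top_of_set F interior_of (\<Union>(range C)) = {}"
    proof (intro Baire_category_alt disjI1 conjI)
      show "completely_metrizable_space (top_of_set F)"
        using fE completely_metrizable_space_closedin[OF completely_metrizable_space_euclidean]
        by (simp add: F_def)
      fix T assume "T \<in> range C"
      thus "closedin (top_of_set F) T"
        using CF by (auto simp: C_def intro!: closed_subset)
    qed auto
    moreover have "\<Union>(range C) = F" using cover CF by auto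
    moreover have "top_of_set F interior_of F = F"
      using interior_of_topspace[of "top_of_set F"] by simp
    ultimately show False using subspace_0[OF sF] by auto
  qed
  then obtain n y0 where y0: "y0 \<in> top_of_set F interior_of C n" by blast
  have "openin (top_of_set F) (top_of_set F interior_of C n)"
    by (rule openin_interior_of)
  then obtain r where r: "r > 0" and ball: "ball y0 r \<inter> F \<subseteq> C n" and y0F: "y0 \<in> F"
    using y0 interior_of_subset[of "top_of_set F" "C n"]
    by (metis (no_types, lifting) openin_contains_ball subset_trans openin_imp_subset subsetD)
  have near: "(1/2) *\<^sub>R y \<in> C n" if y: "y \<in> F" "norm y < r" for y
  proof -
    have "y0 + y \<in> C n" "y0 \<in> C n"
      using ball y r y0F subspace_add[OF sF] by (auto simp: dist_norm)
    then obtain a b where a: "\<And>i. a i \<in> f ` (E \<inter> cball 0 (real n))" "a \<longlonglongrightarrow> y0 + y"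
      and b: "\<And>i. b i \<in> f ` (E \<inter> cball 0 (real n))" "b \<longlonglongrightarrow> y0"
      unfolding C_def closure_sequential by blast
    have "(1/2) *\<^sub>R (a i - b i) \<in> f ` (E \<inter> cball 0 (real n))" for i
    proof -
      obtain u v where uv: "u \<in> E" "norm u \<le> n" "a i = f u" "v \<in> E" "norm v \<le> n" "b i = f v"
        using a(1)[of i] b(1)[of i] by auto
      have "norm ((1/2) *\<^sub>R (u - v)) \<le> n"
        using norm_triangle_ineq4[of u v] uv by simp
      moreover have "(1/2) *\<^sub>R (u - v) \<in> E"
        using uv E(2) by (simp add: subspace_diff subspace_scale)
      moreover have "f ((1/2) *\<^sub>R (u - v)) = (1/2) *\<^sub>R (a i - b i)"
        using uv by (simp add: scaleR diff)
      ultimately show ?thesis by (intro image_eqI[of _ _ "(1/2) *\<^sub>R (u - v)"]) auto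
    qed
    moreover have "(\<lambda>i. (1/2) *\<^sub>R (a i - b i)) \<longlonglongrightarrow> (1/2) *\<^sub>R (y0 + y - y0)"
      by (intro tendsto_intros a b)
    hence "(\<lambda>i. (1/2) *\<^sub>R (a i - b i)) \<longlonglongrightarrow> (1/2) *\<^sub>R y" by simp
    ultimately show ?thesis
      unfolding C_def closure_sequential by (intro exI[of _ "\<lambda>i. (1/2) *\<^sub>R (a i - b i)"]) auto
  qed
  \<comment> \<open>\<open>y\<close> is scaled to norm \<open>r / 2\<close>, halved by \<open>near\<close>, solved up to \<open>r / 8\<close> and scaled back by \<open>4 * norm y / r\<close>.\<close>
  define K where "K = 4 * real n / r"
  have K0: "K \<ge> 0" using r by (simp add: K_def)
  have approx: "\<exists>x\<in>E. norm x \<le> K * norm y \<and> norm (y - f x) \<le> norm y / 2" if y: "y \<in> F" for y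
  proof (cases "y = 0")
    case True
    thus ?thesis using subspace_0[OF E(2)] by (intro bexI[of _ 0]) (auto simp: zero)
  next
    case False
    define s where "s = 4 * norm y / r"
    have s: "s > 0" using r False by (simp add: s_def)
    have "(1/2) *\<^sub>R ((2/s) *\<^sub>R y) \<in> C n"
      using r False y by (intro near subspace_scale[OF sF]) (auto simp: s_def field_simps)
    hence app: "\<forall>e>0. \<exists>z \<in> f ` (E \<inter> cball 0 (real n)). dist z ((1/2) *\<^sub>R ((2/s) *\<^sub>R y)) < e"
      unfolding C_def closure_approachable .
    have "\<exists>z \<in> f ` (E \<inter> cball 0 (real n)). dist z ((1/2) *\<^sub>R ((2/s) *\<^sub>R y)) < r / 8"
      by (rule app[rule_format]) (use r in simp)
    then obtain x where x: "x \<in> E" "norm x \<le> n" "norm (f x - (1/s) *\<^sub>R y) < r / 8"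
      by (auto simp: dist_norm)
    have "norm (y - f (s *\<^sub>R x)) = s * norm (f x - (1/s) *\<^sub>R y)"
    proof -
      have "f (s *\<^sub>R x) - y = s *\<^sub>R (f x - (1/s) *\<^sub>R y)"
        using s by (simp add: scaleR algebra_simps)
      thus ?thesis using s by (metis abs_of_pos norm_minus_commute norm_scaleR)
    qed
    also have "\<dots> \<le> s * (r / 8)" using x s by (intro mult_left_mono) auto
    also have "\<dots> = norm y / 2" using r by (simp add: s_def)
    finally have "norm (y - f (s *\<^sub>R x)) \<le> norm y / 2" .
    moreover have "norm (s *\<^sub>R x) \<le> K * norm y"
    proof -
      have "norm (s *\<^sub>R x) \<le> s * n" using x s by (simp add: mult_left_mono)
      moreover have "s * n = K * norm y" by (simp add: s_def K_def)
      ultimately show ?thesis by simp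
    qed
    ultimately show ?thesis using subspace_scale[OF E(2) x(1), of s] by blast
  qed
  have "\<exists>x\<in>E. f x = y \<and> norm x \<le> (2 * K + 1) * norm y" if y: "y \<in> F" for y
    using exact_solution_of_approximate[OF f E sF _ K0 approx y]
    by (force simp: F_def algebra_simps intro: add_increasing)
  thus thesis
    using K0 by (intro that[of "2 * K + 1"]) (auto simp: F_def)
qed

text \<open>A surjection with a norm bound on solutions survives a small perturbation, with the bound doubled.
It plays the role of the Neumann series and is the source of all stability results below.\<close>

lemma perturbed_surjection:
  fixes f h :: "'a::banach \<Rightarrow> 'b::real_normed_vector"
  assumes f: "bounded_linear f" "f ` E \<subseteq> F" and h: "bounded_linear h" "h ` E \<subseteq> F"
    and E: "closed E" "subspace E" and F: "subspace F" and k0: "k \<ge> 0"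
    and onto: "\<And>y. y \<in> F \<Longrightarrow> \<exists>x\<in>E. f x = y \<and> norm x \<le> k * norm y"
    and small: "\<And>x. x \<in> E \<Longrightarrow> norm (h x) \<le> e * norm x" "e \<ge> 0" "e * k \<le> 1/2"
    and y: "y \<in> F"
  shows "\<exists>x\<in>E. f x - h x = y \<and> norm x \<le> 2 * k * norm y"
proof -
  have "\<exists>x\<in>E. norm x \<le> k * norm z \<and> norm (z - (f x - h x)) \<le> norm z / 2" if z: "z \<in> F" for z
  proof -
    obtain x where x: "x \<in> E" "f x = z" "norm x \<le> k * norm z" using onto[OF z] by blast
    have "norm (h x) \<le> e * (k * norm z)"
      using small(1)[OF x(1)] mult_left_mono[OF x(3) small(2)] by linarith
    also have "\<dots> \<le> 1/2 * norm z"
      using mult_right_mono[OF small(3), of "norm z"] by (simp add: mult.assoc)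
    finally show ?thesis using x by (intro bexI[of _ x]) auto
  qed
  moreover have "(\<lambda>x. f x - h x) ` E \<subseteq> F"
    using f h F by (auto intro!: subspace_diff)
  ultimately show ?thesis
    using exact_solution_of_approximate[OF bounded_linear_sub[OF f(1) h(1)] E F _ k0 _ y] by auto
qed

lemma bounded_opsI:
  "bounded_linear T \<Longrightarrow> (\<And>c x. T (c *\<^sub>C x) = c *\<^sub>C T x) \<Longrightarrow> T \<in> bounded_ops"
  by (simp add: bounded_ops_def)

lemma comp_bounded_ops: "S \<in> bounded_ops \<Longrightarrow> T \<in> bounded_ops \<Longrightarrow> S \<circ> T \<in> bounded_ops"
  unfolding bounded_ops_def comp_def by (auto intro: bounded_linear_compose)

lemma funpow_bounded_ops: "(T :: 'a::complex_banach \<Rightarrow> 'a) \<in> bounded_ops \<Longrightarrow> T ^^ n \<in> bounded_ops"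
proof (induction n)
  case 0
  have "T ^^ 0 = (\<lambda>x. x)" by auto
  thus ?case by (simp only:) (rule bounded_opsI[OF bounded_linear_ident refl])
next
  case (Suc n)
  hence "T \<circ> T ^^ n \<in> bounded_ops" by (intro comp_bounded_ops)
  thus ?case by (simp only: funpow.simps)
qed

lemma shift_bounded_ops: "T \<in> bounded_ops \<Longrightarrow> shift_op T l \<in> bounded_ops"
  unfolding bounded_ops_def shift_op_def
  by (auto intro!: bounded_linear_sub bounded_linear_scaleC
      simp: complex_vector.scale_right_diff_distrib scaleC_scaleC mult.commute)

lemma complex_linear: "T \<in> bounded_ops \<Longrightarrow> Vector_Spaces.linear scaleC scaleC T"
  unfolding Vector_Spaces.linear_iff
  by (auto simp: bounded_opsD complex_vector.vector_space_axioms)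

interpretation complex_pair: vector_space_pair
  "scaleC :: complex \<Rightarrow> 'a \<Rightarrow> 'a::complex_banach" "scaleC :: complex \<Rightarrow> 'b \<Rightarrow> 'b::complex_banach"
  by unfold_locales

lemma complex_subspace_range: "T \<in> bounded_ops \<Longrightarrow> complex_vector.subspace (range T)"
  by (rule complex_pair.linear_subspace_image[OF complex_linear complex_vector.subspace_UNIV])

lemma complex_subspace_image:
  "T \<in> bounded_ops \<Longrightarrow> complex_vector.subspace S \<Longrightarrow> complex_vector.subspace (T ` S)"
  by (rule complex_pair.linear_subspace_image[OF complex_linear])

lemma complex_subspace_kernel: "T \<in> bounded_ops \<Longrightarrow> complex_vector.subspace (kernel T)"
  unfolding kernel_def by (rule complex_pair.linear_subspace_kernel[OF complex_linear])

lemma closed_kernel: "T \<in> bounded_ops \<Longrightarrow> closed (kernel T)"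
  unfolding kernel_def
  by (intro closed_Collect_eq continuous_on_const linear_continuous_on bounded_opsD)

text \<open>An operator range with a closed algebraic complement is closed: by the open mapping theorem for
\<open>(x, w) \<mapsto> f x + w\<close>, the component in \<open>W\<close> of a vector \<open>y\<close> is bounded by a multiple of the distance
from \<open>y\<close> to any point of the range, so it vanishes for limits of points of the range.\<close>

lemma closed_range_if_closed_complement:
  fixes f :: "'a::banach \<Rightarrow> 'b::banach"
  assumes f: "bounded_linear f" and W: "closed W" "subspace W"
    and inter: "\<And>x. f x \<in> W \<Longrightarrow> f x = 0" and cover: "\<And>y. \<exists>x. y - f x \<in> W"
  shows "closed (range f)"
proof -
  interpret bounded_linear f by fact
  define g where "g p = f (fst p) + snd p" for p :: "'a \<times> 'b"
  have g: "bounded_linear g"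
    unfolding g_def
    by (intro bounded_linear_add bounded_linear_compose[OF f] bounded_linear_fst bounded_linear_snd)
  have gU: "g ` (UNIV \<times> W) = UNIV"
  proof -
    have "y \<in> g ` (UNIV \<times> W)" for y
    proof -
      obtain x where "y - f x \<in> W" using cover by blast
      thus ?thesis by (intro image_eqI[of _ _ "(x, y - f x)"]) (auto simp: g_def)
    qed
    thus ?thesis by auto
  qed
  have E: "closed (UNIV \<times> W :: ('a \<times> 'b) set)" "subspace (UNIV \<times> W :: ('a \<times> 'b) set)"
    using W by (auto intro!: closed_Times subspace_Times)
  obtain k where k: "k > 0"
    "\<And>y. y \<in> g ` (UNIV \<times> W) \<Longrightarrow> \<exists>p\<in>UNIV \<times> W. g p = y \<and> norm p \<le> k * norm y"
    using open_mapping_bound[OF g E] gU by auto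
  show ?thesis
    unfolding closed_sequential_limits
  proof safe
    fix s y assume s: "\<forall>n. s n \<in> range f" and lim: "s \<longlonglongrightarrow> y"
    obtain x where x: "y - f x \<in> W" using cover by blast
    have bound: "norm (y - f x) \<le> k * norm (y - s n)" for n
    proof -
      obtain u where u: "s n = f u" using s by blast
      obtain z w where zw: "w \<in> W" "f z + w = y - s n" "norm (z, w) \<le> k * norm (y - s n)"
        using k(2)[of "y - s n"] gU by (auto simp: g_def)
      have "y - f x - w = f (u + z - x)"
        using zw(2) u by (simp add: diff add algebra_simps)
      moreover have "y - f x - w \<in> W" using x zw(1) W(2) by (rule_tac subspace_diff)
      ultimately have "y - f x - w = 0" using inter by metis
      thus ?thesis using zw(3) norm_snd_le[of w z] by simp
    qed
    have "(\<lambda>n. k * norm (y - s n)) \<longlonglongrightarrow> k * norm (y - y)"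
      by (intro tendsto_intros lim)
    hence "norm (y - f x) \<le> 0"
      by (intro LIMSEQ_le_const[of "\<lambda>n. k * norm (y - s n)"]) (use bound in auto)
    thus "y \<in> range f" by auto
  qed
qed

section \<open>Finite-dimensional subspaces\<close>

lemma distance_to_closed_subspace:
  assumes "closed E" "v \<notin> E"
  obtains d where "d > 0" "\<And>e. e \<in> E \<Longrightarrow> d \<le> norm (v - e)"
proof -
  have "open (- E)" "v \<in> - E" using assms by auto
  then obtain d where "d > 0" "ball v d \<subseteq> - E" by (meson open_contains_ball)
  thus thesis by (intro that[of d]) (force simp: dist_norm)+
qed

text \<open>Adding one vector \<open>v\<close> at positive distance from \<open>E\<close> keeps a subspace closed, because the
coefficient of \<open>v\<close> is then controlled by the norm, so that coefficients of a convergent sequence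
converge.\<close>

lemma closed_span_insert:
  fixes E :: "'a::complex_banach set"
  assumes E: "closed E" "complex_vector.subspace E"
  shows "closed (complex_vector.span (insert v E))"
proof (cases "v \<in> E")
  case True
  thus ?thesis using E by (simp add: insert_absorb complex_vector.span_eq_iff[THEN iffD2])
next
  case False
  have span: "complex_vector.span (insert v E) = {x. \<exists>c. x - c *\<^sub>C v \<in> E}"
    unfolding complex_vector.span_insert using E(2) by (simp add: complex_vector.span_eq_iff[THEN iffD2])
  obtain d where d: "d > 0" "\<And>e. e \<in> E \<Longrightarrow> d \<le> norm (v - e)"
    using distance_to_closed_subspace[OF E(1) False] by blast
  have coeff: "cmod c * d \<le> norm x" if x: "x - c *\<^sub>C v \<in> E" for x c
  proof (cases "c = 0")
    case False
    have "d \<le> norm (v - (- inverse c) *\<^sub>C (x - c *\<^sub>C v))"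
      by (intro d complex_vector.subspace_scale E x)
    also have "v - (- inverse c) *\<^sub>C (x - c *\<^sub>C v) = inverse c *\<^sub>C x"
      using False by (simp add: complex_vector.scale_right_diff_distrib scaleC_scaleC scaleC_one)
    finally have "d \<le> norm x / cmod c"
      by (simp add: norm_scaleC norm_inverse divide_inverse mult.commute)
    thus ?thesis using False by (simp add: pos_le_divide_eq mult.commute)
  qed simp
  show ?thesis
    unfolding closed_sequential_limits
  proof safe
    fix s y assume s: "\<forall>n. s n \<in> complex_vector.span (insert v E)" and lim: "s \<longlonglongrightarrow> y"
    obtain c where c: "\<And>n. s n - c n *\<^sub>C v \<in> E" using s unfolding span by (auto simp: choice_iff)
    have diff: "cmod (c m - c n) * d \<le> norm (s m - s n)" for m n
    proof (rule coeff)
      have "(s m - c m *\<^sub>C v) - (s n - c n *\<^sub>C v) \<in> E"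
        by (intro complex_vector.subspace_diff E c)
      thus "s m - s n - (c m - c n) *\<^sub>C v \<in> E"
        by (simp add: complex_vector.scale_left_diff_distrib algebra_simps)
    qed
    have "Cauchy c"
    proof (rule metric_CauchyI)
      fix e :: real assume "e > 0"
      hence "e * d > 0" using d by simp
      then obtain N where N: "\<And>m n. m \<ge> N \<Longrightarrow> n \<ge> N \<Longrightarrow> norm (s m - s n) < e * d"
        using LIMSEQ_imp_Cauchy[OF lim] unfolding Cauchy_def dist_norm by blast
      have "cmod (c m - c n) < e" if "m \<ge> N" "n \<ge> N" for m n
        using diff[of m n] N[OF that] d(1) by (meson le_less_trans mult_less_cancel_right_pos)
      thus "\<exists>N. \<forall>m\<ge>N. \<forall>n\<ge>N. dist (c m) (c n) < e" by (auto simp: dist_norm)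
    qed
    then obtain l where l: "c \<longlonglongrightarrow> l" by (auto simp: Cauchy_convergent_iff convergent_def)
    have "(\<lambda>n. s n - c n *\<^sub>C v) \<longlonglongrightarrow> y - l *\<^sub>C v"
      by (intro tendsto_diff lim bounded_linear.tendsto[OF bounded_linear_scaleC_left] l)
    with closed_sequentially[OF E(1), of "\<lambda>n. s n - c n *\<^sub>C v"] c
    have "y - l *\<^sub>C v \<in> E" by auto
    thus "y \<in> complex_vector.span (insert v E)" unfolding span by blast
  qed
qed

lemma closed_span_Un_finite:
  fixes E :: "'a::complex_banach set"
  assumes "finite F" "closed E" "complex_vector.subspace E"
  shows "closed (complex_vector.span (E \<union> F))"
  using assms
proof (induction F)
  case empty
  thus ?case by (simp add: complex_vector.span_eq_iff[THEN iffD2])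
next
  case (insert v F)
  have "complex_vector.span (E \<union> insert v F)
      = complex_vector.span (insert v (complex_vector.span (E \<union> F)))"
    unfolding complex_vector.span_insert by (simp add: complex_vector.span_insert complex_vector.span_span)
  thus ?case
    using closed_span_insert[of "complex_vector.span (E \<union> F)" v] insert by simp
qed

lemma closed_span_finite:
  fixes F :: "'a::complex_banach set"
  assumes "finite F" shows "closed (complex_vector.span F)"
  using closed_span_Un_finite[OF assms, of "{0}"]
  by (simp add: complex_vector.subspace_def)

lemma finite_dim_subset: "finite_dim S \<Longrightarrow> R \<subseteq> S \<Longrightarrow> finite_dim R"
  unfolding finite_dim_def by blast

lemma finite_dim_image:
  assumes "finite_dim S" and L: "L \<in> bounded_ops" shows "finite_dim (L ` S)"
proof -
  obtain F where "finite F" "S \<subseteq> complex_vector.span F" using assms by (auto simp: finite_dim_def)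
  hence "finite (L ` F)" "L ` S \<subseteq> complex_vector.span (L ` F)"
    unfolding complex_pair.linear_span_image[OF complex_linear[OF L]] by auto
  thus ?thesis unfolding finite_dim_def by blast
qed

lemma finite_dim_basis:
  assumes "finite_dim S"
  obtains B where "finite B" "B \<subseteq> S" "complex_vector.independent B" "S \<subseteq> complex_vector.span B"
proof -
  obtain B where B: "B \<subseteq> S" "complex_vector.independent B" "S \<subseteq> complex_vector.span B"
    using complex_vector.maximal_independent_subset by blast
  obtain F where "finite F" "S \<subseteq> complex_vector.span F" using assms by (auto simp: finite_dim_def)
  hence "finite B" using complex_vector.independent_span_bound B by blast
  thus thesis using that B by blast
qed

text \<open>The finiteness half of the rank-nullity theorem: lift a basis of the image and add a basis of the
kernel.\<close>

lemma finite_dim_if_image_and_kernel: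
  assumes U: "complex_vector.subspace U" and L: "L \<in> bounded_ops"
    and im: "finite_dim (L ` U)" and ker: "finite_dim (U \<inter> kernel L)"
  shows "finite_dim U"
proof -
  obtain B where B: "finite B" "B \<subseteq> L ` U" "complex_vector.independent B" "L ` U \<subseteq> complex_vector.span B"
    by (rule finite_dim_basis[OF im])
  obtain D where D: "D \<subseteq> U" "finite D" "B = L ` D"
    using finite_subset_image[OF B(1,2)] by metis
  obtain F where F: "finite F" "U \<inter> kernel L \<subseteq> complex_vector.span F"
    using ker by (auto simp: finite_dim_def)
  have "U \<subseteq> complex_vector.span (D \<union> F)"
  proof
    fix u assume u: "u \<in> U"
    have "L u \<in> L ` complex_vector.span D"
      using B(4) u unfolding D(3) complex_pair.linear_span_image[OF complex_linear[OF L]] by blast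
    then obtain w where w: "w \<in> complex_vector.span D" "L u = L w" by blast
    have "w \<in> U" using w(1) complex_vector.span_minimal[OF D(1) U] by blast
    hence "u - w \<in> U \<inter> kernel L"
      using u w U by (auto simp: kernel_def bounded_opsD[OF L] complex_vector.subspace_diff)
    hence "u - w \<in> complex_vector.span (D \<union> F)"
      using F(2) complex_vector.span_mono[of F "D \<union> F"] by blast
    moreover have "w \<in> complex_vector.span (D \<union> F)"
      using w(1) complex_vector.span_mono[of D "D \<union> F"] by blast
    ultimately show "u \<in> complex_vector.span (D \<union> F)"
      using complex_vector.span_add by fastforce
  qed
  thus ?thesis using D F unfolding finite_dim_def by blast
qed

text \<open>Discarding the vectors of \<open>F\<close> that are redundant modulo \<open>S\<close> leaves a direct complement.\<close>

lemma finite_complement: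
  assumes S: "complex_vector.subspace S" and F: "finite F"
  obtains G where "finite G" "\<And>x. x \<in> S \<Longrightarrow> x \<in> complex_vector.span G \<Longrightarrow> x = 0"
    "complex_vector.span (S \<union> G) = complex_vector.span (S \<union> F)"
proof -
  have "\<exists>G. finite G \<and> S \<inter> complex_vector.span G \<subseteq> {0} \<and>
      complex_vector.span (S \<union> G) = complex_vector.span (S \<union> F)"
    using F
  proof (induction F)
    case empty
    show ?case by (rule exI[of _ "{}"]) simp
  next
    case (insert x F)
    then obtain G where G: "finite G" "S \<inter> complex_vector.span G \<subseteq> {0}"
      "complex_vector.span (S \<union> G) = complex_vector.span (S \<union> F)" by blast
    have ins: "complex_vector.span (S \<union> insert x H) = {y. \<exists>c. y - c *\<^sub>C x \<in> complex_vector.span (S \<union> H)}" for H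
      by (simp add: complex_vector.span_insert)
    show ?case
    proof (cases "x \<in> complex_vector.span (S \<union> G)")
      case True
      hence "complex_vector.span (S \<union> insert x F) = complex_vector.span (S \<union> F)"
        using G(3) by (simp add: complex_vector.span_redundant)
      thus ?thesis using G by (intro exI[of _ G]) simp
    next
      case False
      have "S \<inter> complex_vector.span (insert x G) \<subseteq> {0}"
      proof
        fix y assume y: "y \<in> S \<inter> complex_vector.span (insert x G)"
        then obtain c where c: "y - c *\<^sub>C x \<in> complex_vector.span G"
          by (auto simp: complex_vector.span_insert)
        have "c = 0"
        proof (rule ccontr)
          assume "c \<noteq> 0"
          have "y \<in> complex_vector.span (S \<union> G)" "y - c *\<^sub>C x \<in> complex_vector.span (S \<union> G)"
            using y c complex_vector.span_mono[of G "S \<union> G"] by (auto intro: complex_vector.span_base)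
          hence mem: "inverse c *\<^sub>C (y - (y - c *\<^sub>C x)) \<in> complex_vector.span (S \<union> G)"
            by (intro complex_vector.span_scale) (rule complex_vector.span_diff)
          have "inverse c *\<^sub>C (y - (y - c *\<^sub>C x)) = x"
            using \<open>c \<noteq> 0\<close> by (simp add: scaleC_scaleC scaleC_one)
          from mem[unfolded this] show False using False by blast
        qed
        thus "y \<in> {0}" using c G(2) y by auto
      qed
      thus ?thesis using G ins by (intro exI[of _ "insert x G"]) simp
    qed
  qed
  thus thesis using that by blast
qed

section \<open>Drazin invertibility and limits of resolvent points\<close>

text \<open>Ascent and descent are both at most \<open>p\<close>. Over a Banach space this already makes \<open>T\<close> Drazin
invertible: the range of \<open>T ^^ p\<close> is automatically closed, the space splits into the kernel and the
range of \<open>T ^^ p\<close>, and \<open>T\<close> is nilpotent on the first and bijective on the second.\<close>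

definition drazin_at :: "('a::complex_banach \<Rightarrow> 'a) \<Rightarrow> nat \<Rightarrow> bool"
  where "drazin_at T p \<longleftrightarrow>
    kernel (T ^^ Suc p) \<subseteq> kernel (T ^^ p) \<and> range (T ^^ p) \<subseteq> range (T ^^ Suc p)"

definition drazin :: "('a::complex_banach \<Rightarrow> 'a) \<Rightarrow> bool"
  where "drazin T \<longleftrightarrow> (\<exists>p. drazin_at T p)"

text \<open>The point 0 belongs to the closure of the resolvent set of \<open>T\<close> (it may belong to the resolvent set).\<close>

definition resolvent_limit :: "('a::complex_banach \<Rightarrow> 'a) \<Rightarrow> bool"
  where "resolvent_limit T \<longleftrightarrow> (\<forall>e>0. \<exists>m. cmod m < e \<and> bij (shift_op T m))"

lemma funpow_add_apply: "(T ^^ (m + n)) x = (T ^^ m) ((T ^^ n) x)"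
  by (simp add: funpow_add)

lemma kernel_funpow_stable:
  fixes T :: "'a::complex_banach \<Rightarrow> 'a"
  assumes "kernel (T ^^ Suc p) \<subseteq> kernel (T ^^ p)" "(T ^^ (p + n)) x = 0"
  shows "(T ^^ p) x = 0"
  using assms(2)
proof (induction n)
  case (Suc n)
  have "(T ^^ Suc p) ((T ^^ n) x) = 0"
    using Suc.prems funpow_add_apply[of "Suc p" n T x] by simp
  hence "(T ^^ p) ((T ^^ n) x) = 0" using assms(1) by (auto simp: kernel_def)
  thus ?case using Suc.IH by (simp add: funpow_add_apply)
qed simp

lemma range_funpow_stable:
  fixes T :: "'a \<Rightarrow> 'a"
  assumes "range (T ^^ p) \<subseteq> range (T ^^ Suc p)"
  shows "\<exists>y. (T ^^ p) x = (T ^^ (p + n)) y"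
proof (induction n)
  case (Suc n)
  then obtain y where y: "(T ^^ p) x = (T ^^ (p + n)) y" by blast
  obtain z where z: "(T ^^ p) y = (T ^^ Suc p) z" using assms by blast
  have "(T ^^ p) x = (T ^^ n) ((T ^^ p) y)"
    using y funpow_add_apply[of n p T y] by (simp add: add.commute)
  also have "\<dots> = (T ^^ (n + Suc p)) z" unfolding z funpow_add_apply ..
  finally show ?case by (metis add.commute add_Suc_right)
qed auto

lemma range_funpow_antimono:
  fixes T :: "'a \<Rightarrow> 'a"
  assumes "m \<le> n" shows "range (T ^^ n) \<subseteq> range (T ^^ m)"
proof
  fix y assume "y \<in> range (T ^^ n)"
  then obtain x where "y = (T ^^ (m + (n - m))) x" using assms by auto
  thus "y \<in> range (T ^^ m)" by (simp add: funpow_add_apply)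
qed

lemma kernel_funpow_mono:
  fixes T :: "'a::complex_banach \<Rightarrow> 'a"
  assumes "T \<in> bounded_ops" "m \<le> n" shows "kernel (T ^^ m) \<subseteq> kernel (T ^^ n)"
proof
  fix x assume "x \<in> kernel (T ^^ m)"
  hence "(T ^^ ((n - m) + m)) x = 0"
    unfolding funpow_add_apply
    by (simp add: kernel_def bounded_opsD(5)[OF funpow_bounded_ops[OF assms(1)]])
  thus "x \<in> kernel (T ^^ n)" using assms(2) by (simp add: kernel_def)
qed

lemma image_range_funpow: "T ` range (T ^^ p) = range (T ^^ Suc p)"
  by auto

lemma drazin_atD:
  assumes "drazin_at T p"
  shows "kernel (T ^^ Suc p) \<subseteq> kernel (T ^^ p)" "range (T ^^ p) \<subseteq> range (T ^^ Suc p)"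
  using assms unfolding drazin_at_def by blast+

lemma drazin_at_mono:
  fixes T :: "'a::complex_banach \<Rightarrow> 'a"
  assumes T: "T \<in> bounded_ops" and p: "drazin_at T p" "p \<le> q"
  shows "drazin_at T q"
  unfolding drazin_at_def
proof
  show "kernel (T ^^ Suc q) \<subseteq> kernel (T ^^ q)"
  proof
    fix x assume "x \<in> kernel (T ^^ Suc q)"
    hence "(T ^^ (p + (Suc q - p))) x = 0" using p(2) by (simp add: kernel_def)
    hence "(T ^^ p) x = 0" by (rule kernel_funpow_stable[OF drazin_atD(1)[OF p(1)]])
    hence "x \<in> kernel (T ^^ p)" by (simp add: kernel_def)
    thus "x \<in> kernel (T ^^ q)" using kernel_funpow_mono[OF T p(2)] by blast
  qed
  show "range (T ^^ q) \<subseteq> range (T ^^ Suc q)"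
  proof
    fix y assume "y \<in> range (T ^^ q)"
    then obtain x where x: "y = (T ^^ ((q - p) + p)) x" using p(2) by auto
    obtain z where "(T ^^ p) x = (T ^^ Suc p) z" using p(1) unfolding drazin_at_def by blast
    hence "y = (T ^^ ((q - p) + Suc p)) z" unfolding x funpow_add_apply by simp
    also have "(q - p) + Suc p = Suc q" using p(2) by simp
    finally show "y \<in> range (T ^^ Suc q)" by blast
  qed
qed

lemma drazin_split:
  fixes T :: "'a::complex_banach \<Rightarrow> 'a"
  assumes T: "T \<in> bounded_ops" and p: "drazin_at T p"
  shows "\<exists>y. (T ^^ p) (x - (T ^^ p) y) = 0"
proof -
  obtain y where "(T ^^ p) x = (T ^^ (p + p)) y"
    using range_funpow_stable[OF drazin_atD(2)[OF p]] by blast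
  thus ?thesis
    by (intro exI[of _ y]) (simp add: bounded_opsD(4)[OF funpow_bounded_ops[OF T]] funpow_add_apply)
qed

lemma drazin_kernel_inter_range:
  fixes T :: "'a::complex_banach \<Rightarrow> 'a"
  assumes "drazin_at T p" "(T ^^ p) ((T ^^ p) y) = 0"
  shows "(T ^^ p) y = 0"
  by (rule kernel_funpow_stable[OF drazin_atD(1)[OF assms(1)], of p])
     (simp only: funpow_add_apply assms(2))

text \<open>The kernel of \<open>T ^^ p\<close> is a closed complement of the range.\<close>

lemma drazin_closed_range:
  fixes T :: "'a::complex_banach \<Rightarrow> 'a"
  assumes T: "T \<in> bounded_ops" and p: "drazin_at T p"
  shows "closed (range (T ^^ p))"
proof (rule closed_range_if_closed_complement[where W = "kernel (T ^^ p)"])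
  show "bounded_linear (T ^^ p)" by (rule bounded_opsD(1)[OF funpow_bounded_ops[OF T]])
  show "closed (kernel (T ^^ p))" "subspace (kernel (T ^^ p))"
    by (auto intro: closed_kernel complex_subspace_imp_subspace complex_subspace_kernel funpow_bounded_ops T)
qed (use drazin_split[OF T p] drazin_kernel_inter_range[OF p] in \<open>auto simp: kernel_def\<close>)

lemma bounded_ops_bijI:
  assumes "T \<in> bounded_ops" "\<And>x. T x = 0 \<Longrightarrow> x = 0" "\<And>y. \<exists>x. T x = y"
  shows "bij T"
  unfolding bij_def
proof
  show "inj T"
    using assms(2) bounded_opsD(4)[OF assms(1)] by (intro injI) (metis right_minus_eq)
  show "surj T" using assms(3) unfolding surj_def by metis
qed

lemma bij_bounded_opsD:
  assumes "T \<in> bounded_ops" "bij T" "T x = 0" shows "x = 0"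
  using injD[OF bij_is_inj[OF assms(2)], of x 0] assms(3) by (simp add: bounded_opsD(5)[OF assms(1)])

text \<open>If \<open>T\<close> maps a closed subspace \<open>R\<close> onto itself, so does \<open>T - m\<close> for all small \<open>m\<close>, with a bound on
solutions that does not depend on \<open>m\<close>.\<close>

lemma shifted_surjection:
  assumes T: "T \<in> bounded_ops" and R: "closed R" "complex_vector.subspace R" "T ` R = R"
  shows "\<exists>k>0. (\<forall>y\<in>R. \<exists>x\<in>R. T x = y \<and> norm x \<le> k * norm y) \<and>
    (\<forall>m. \<forall>y\<in>R. cmod m * k \<le> 1/2 \<longrightarrow> (\<exists>x\<in>R. shift_op T m x = y \<and> norm x \<le> 2 * k * norm y))"
proof -
  note sub = complex_subspace_imp_subspace[OF R(2)]
  have "closed (T ` R)" using R by simp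
  then obtain k where k: "k > 0" "\<And>y. y \<in> T ` R \<Longrightarrow> \<exists>x\<in>R. T x = y \<and> norm x \<le> k * norm y"
    using open_mapping_bound[OF bounded_opsD(1)[OF T] R(1) sub] by auto
  show ?thesis
  proof (intro exI[of _ k] conjI k(1) ballI allI impI)
    show onto: "\<exists>x\<in>R. T x = y \<and> norm x \<le> k * norm y" if "y \<in> R" for y
      using k(2) that R(3) by blast
    fix m y assume y: "y \<in> R" and m: "cmod m * k \<le> 1/2"
    show "\<exists>x\<in>R. shift_op T m x = y \<and> norm x \<le> 2 * k * norm y"
      unfolding shift_op_def
    proof (rule perturbed_surjection[OF bounded_opsD(1)[OF T] _ bounded_linear_scaleC _ R(1) sub sub _ onto _ _ m y])
      show "(*\<^sub>C) m ` R \<subseteq> R" using R(2) by (auto intro: complex_vector.subspace_scale)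
    qed (use R(3) k(1) in \<open>auto simp: norm_scaleC\<close>)
  qed
qed

text \<open>Kernel vectors of a surjection persist: if \<open>T x = 0\<close>, a correction \<open>w\<close> of norm \<open>O(m)\<close> makes
\<open>x + w\<close> a kernel vector of \<open>T - m\<close>. When \<open>T - m\<close> is bijective for arbitrarily small \<open>m\<close>, this
forces \<open>x = 0\<close>.\<close>

lemma resolvent_limit_injective_on:
  assumes T: "T \<in> bounded_ops" and lim: "resolvent_limit T"
    and R: "closed R" "complex_vector.subspace R" "T ` R = R" and x: "x \<in> R" "T x = 0"
  shows "x = 0"
proof (rule ccontr)
  assume "x \<noteq> 0"
  obtain k where k: "k > 0" "\<forall>y\<in>R. \<exists>x\<in>R. T x = y \<and> norm x \<le> k * norm y"
    "\<forall>m. \<forall>y\<in>R. cmod m * k \<le> 1/2 \<longrightarrow> (\<exists>x\<in>R. shift_op T m x = y \<and> norm x \<le> 2 * k * norm y)"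
    using shifted_surjection[OF T R] by blast
  obtain m where m: "cmod m < 1 / (4 * k)" "bij (shift_op T m)"
    using lim[unfolded resolvent_limit_def, rule_format, of "1 / (4 * k)"] k(1) by auto
  have mk: "cmod m * k < 1/4" using m(1) k(1) by (simp add: field_simps)
  have "m *\<^sub>C x \<in> R" using R(2) x(1) by (rule complex_vector.subspace_scale)
  then obtain w where w: "shift_op T m w = m *\<^sub>C x" "norm w \<le> 2 * k * norm (m *\<^sub>C x)"
    using k(3)[rule_format, of "m *\<^sub>C x" m] mk by auto
  have "shift_op T m (x + w) = 0"
    using w(1) x(2) by (simp add: bounded_opsD(3)[OF shift_bounded_ops[OF T]]) (simp add: shift_op_def)
  hence "x + w = 0" by (rule bij_bounded_opsD[OF shift_bounded_ops[OF T] m(2)])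
  hence "norm x = norm w" by (metis add_eq_0_iff norm_minus_cancel)
  also have "\<dots> \<le> 2 * (cmod m * k) * norm x" using w(2) by (simp add: norm_scaleC mult_ac)
  also have "\<dots> < 1 * norm x" using mk \<open>x \<noteq> 0\<close> by (intro mult_strict_right_mono) auto
  finally show False by simp
qed

lemma funpow_eigenvector:
  fixes T :: "'a::complex_banach \<Rightarrow> 'a"
  assumes T: "T \<in> bounded_ops" and "T x = m *\<^sub>C x"
  shows "(T ^^ p) x = (m ^ p) *\<^sub>C x"
  by (induction p) (auto simp: scaleC_one bounded_opsD(2)[OF T] assms(2) scaleC_scaleC mult.commute)

lemma shift_surjective_on_nilpotent:
  fixes T :: "'a::complex_banach \<Rightarrow> 'a"
  assumes T: "T \<in> bounded_ops" and m: "m \<noteq> 0"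
  shows "(T ^^ p) y = 0 \<Longrightarrow> \<exists>x. shift_op T m x = y"
proof (induction p arbitrary: y)
  case 0
  hence "shift_op T m 0 = y" by (simp add: bounded_opsD(5)[OF shift_bounded_ops[OF T]])
  thus ?case ..
next
  case (Suc p)
  have "(T ^^ p) (T y) = 0" using Suc.prems by (simp add: funpow_swap1)
  then obtain z where z: "shift_op T m z = T y" using Suc.IH by blast
  have "shift_op T m (inverse m *\<^sub>C (z - y)) = inverse m *\<^sub>C (T y - shift_op T m y)"
    unfolding bounded_opsD(2)[OF shift_bounded_ops[OF T]] bounded_opsD(4)[OF shift_bounded_ops[OF T]] z ..
  also have "\<dots> = y" using m by (simp add: shift_op_def scaleC_scaleC scaleC_one)
  finally show ?case ..
qed

text \<open>On the range of \<open>T ^^ p\<close> the operator \<open>T\<close> is bijective, hence \<open>T - m\<close> is for small \<open>m\<close>; on the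
kernel of \<open>T ^^ p\<close> it is nilpotent, hence \<open>T - m\<close> is bijective for every \<open>m \<noteq> 0\<close>.\<close>

lemma drazin_punctured_disc:
  assumes T: "T \<in> bounded_ops" and "drazin T"
  obtains d where "d > 0" "\<And>m. m \<noteq> 0 \<Longrightarrow> cmod m < d \<Longrightarrow> bij (shift_op T m)"
proof -
  obtain p where p: "drazin_at T p" using assms(2) by (auto simp: drazin_def)
  note Tp = funpow_bounded_ops[OF T, of p]
  define R where "R = range (T ^^ p)"
  have R: "closed R" "complex_vector.subspace R" "T ` R = R"
    using drazin_closed_range[OF T p] complex_subspace_range[OF Tp] image_range_funpow[of T p] p
      range_funpow_antimono[of p "Suc p" T]
    by (auto simp: R_def drazin_at_def)
  obtain k where k: "k > 0" "\<forall>y\<in>R. \<exists>x\<in>R. T x = y \<and> norm x \<le> k * norm y"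
    "\<forall>m. \<forall>y\<in>R. cmod m * k \<le> 1/2 \<longrightarrow> (\<exists>x\<in>R. shift_op T m x = y \<and> norm x \<le> 2 * k * norm y)"
    using shifted_surjection[OF T R] by blast
  have inj: "x = 0" if x: "x \<in> R" "T x = 0" for x
  proof -
    obtain y where "x = (T ^^ p) y" using x(1) by (auto simp: R_def)
    thus ?thesis using x(2) p by (auto simp: drazin_at_def kernel_def)
  qed
  show thesis
  proof (rule that[of "1 / (2 * k)"])
    show "1 / (2 * k) > 0" using k(1) by simp
    fix m assume m: "m \<noteq> 0" "cmod m < 1 / (2 * k)"
    have mk: "cmod m * k < 1/2" using m(2) k(1) by (simp add: field_simps)
    note S = shift_bounded_ops[OF T, of m]
    show "bij (shift_op T m)"
    proof (rule bounded_ops_bijI[OF S])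
      fix x assume "shift_op T m x = 0"
      hence Tx: "T x = m *\<^sub>C x" by (simp add: shift_op_def)
      have "x = (T ^^ p) (inverse (m ^ p) *\<^sub>C x)"
        using m(1) by (simp add: bounded_opsD(2)[OF Tp] funpow_eigenvector[OF T Tx] scaleC_scaleC scaleC_one)
      hence xR: "x \<in> R" unfolding R_def by blast
      hence "m *\<^sub>C x \<in> R" using R(2) complex_vector.subspace_scale by blast
      then obtain x' where x': "x' \<in> R" "T x' = m *\<^sub>C x" "norm x' \<le> k * norm (m *\<^sub>C x)"
        using k(2)[rule_format, OF \<open>m *\<^sub>C x \<in> R\<close>] by metis
      have "x' - x = 0"
        by (rule inj[OF complex_vector.subspace_diff[OF R(2) x'(1) xR]]) (simp add: bounded_opsD(4)[OF T] x'(2) Tx)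
      hence "norm x \<le> (cmod m * k) * norm x" using x'(3) by (simp add: norm_scaleC mult_ac)
      also have "\<dots> \<le> 1/2 * norm x" using mk by (intro mult_right_mono) auto
      finally show "x = 0" by simp
    next
      fix y
      obtain z where z: "(T ^^ p) (y - (T ^^ p) z) = 0" using drazin_split[OF T p] by blast
      obtain a where a: "shift_op T m a = (T ^^ p) z"
        using k(3)[rule_format, of "(T ^^ p) z" m] mk by (auto simp: R_def)
      obtain b where b: "shift_op T m b = y - (T ^^ p) z"
        using shift_surjective_on_nilpotent[OF T m(1) z] by blast
      have "shift_op T m (a + b) = y" using a b by (simp add: bounded_opsD(3)[OF S])
      thus "\<exists>x. shift_op T m x = y" ..
    qed
  qed
qed

lemma drazin_resolvent_limit:
  assumes "T \<in> bounded_ops" "drazin T" shows "resolvent_limit T"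
  unfolding resolvent_limit_def
proof safe
  fix e :: real assume e: "e > 0"
  obtain d where d: "d > 0" "\<And>m. m \<noteq> 0 \<Longrightarrow> cmod m < d \<Longrightarrow> bij (shift_op T m)"
    using drazin_punctured_disc[OF assms] by blast
  have "min d e / 2 > 0" "min d e / 2 < d" "min d e / 2 < e" using d(1) e by auto
  thus "\<exists>m. cmod m < e \<and> bij (shift_op T m)"
    using d(2)[of "of_real (min d e / 2)"] by (intro exI[of _ "of_real (min d e / 2)"]) (auto simp del: of_real_divide)
qed

lemma shift_funpow_commute:
  fixes T :: "'a::complex_banach \<Rightarrow> 'a"
  assumes T: "T \<in> bounded_ops"
  shows "shift_op T m ((T ^^ p) u) = (T ^^ p) (shift_op T m u)"
  by (simp add: shift_op_def bounded_opsD(2,4)[OF funpow_bounded_ops[OF T]] funpow_swap1)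

lemma subspace_closure:
  fixes S :: "'a::real_normed_vector set"
  assumes "subspace S" shows "subspace (closure S)"
proof (rule subspaceI)
  show "0 \<in> closure S" using subspace_0[OF assms] closure_subset by blast
  show "x + y \<in> closure S" if xy: "x \<in> closure S" "y \<in> closure S" for x y
  proof -
    obtain f g where "\<forall>n. f n \<in> S" "f \<longlonglongrightarrow> x" "\<forall>n. g n \<in> S" "g \<longlonglongrightarrow> y"
      using xy unfolding closure_sequential by blast
    thus ?thesis unfolding closure_sequential
      by (intro exI[of _ "\<lambda>n. f n + g n"]) (auto intro: tendsto_add subspace_add[OF assms])
  qed
  show "c *\<^sub>R x \<in> closure S" if x: "x \<in> closure S" for c x
  proof -
    obtain f where "\<forall>n. f n \<in> S" "f \<longlonglongrightarrow> x"
      using x unfolding closure_sequential by blast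
    thus ?thesis unfolding closure_sequential
      by (intro exI[of _ "\<lambda>n. c *\<^sub>R f n"]) (auto intro: tendsto_scaleR subspace_scale[OF assms])
  qed
qed

text \<open>On the closure \<open>M\<close> of the range of \<open>T ^^ p\<close> the operator \<open>T\<close> is bounded below, and it is a limit of
operators \<open>T - m\<close> that are onto on a dense subspace of \<open>M\<close>; preimages stay bounded because of the
lower bound, so \<open>T\<close> maps \<open>M\<close> onto \<open>M\<close>. Then \<open>M\<close> is contained in the range of every power of \<open>T\<close>.
Working with the closure makes the lemma applicable to the corner \<open>A\<close> of a triangular operator,
which inherits the lower bound but not directly the closedness of the range.\<close>

lemma drazin_if_bounded_below:
  fixes T :: "'a::complex_banach \<Rightarrow> 'a"
  assumes T: "T \<in> bounded_ops" and lim: "resolvent_limit T"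
    and below: "c > 0" "\<And>x. norm ((T ^^ p) x) \<le> c * norm ((T ^^ Suc p) x)"
  shows "drazin_at T p"
proof -
  note Tp = funpow_bounded_ops[OF T, of p]
  note cont = linear_continuous_on[OF bounded_opsD(1)[OF T]]
  define R where "R = range (T ^^ p)"
  define M where "M = closure R"
  have M: "closed M" "subspace M"
    using complex_subspace_imp_subspace[OF complex_subspace_range[OF Tp]]
    by (auto simp: M_def R_def subspace_closure)
  have "R \<subseteq> {y. norm y \<le> c * norm (T y)}"
    using below(2) by (auto simp: R_def)
  hence "M \<subseteq> {y. norm y \<le> c * norm (T y)}"
    unfolding M_def by (intro closure_minimal closed_Collect_le continuous_intros cont)
  hence belowM: "norm y \<le> c * norm (T y)" if "y \<in> M" for y using that by blast
  have TMM: "T ` M \<subseteq> M"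
    unfolding M_def
  proof (rule image_closure_subset[OF cont])
    have "T ` R \<subseteq> R"
      unfolding R_def image_range_funpow by (rule range_funpow_antimono) simp
    thus "T ` R \<subseteq> closure R" using closure_subset by blast
  qed simp
  have "complete (T ` M)"
  proof (rule complete_isometric_image[of "inverse c" M T])
    show "\<forall>x\<in>M. inverse c * norm x \<le> norm (T x)"
      using belowM below(1) by (simp add: field_simps)
  qed (use below(1) M bounded_opsD(1)[OF T] in \<open>auto simp: complete_eq_closed\<close>)
  hence clTM: "closed (T ` M)" by (simp add: complete_eq_closed)
  have "R \<subseteq> T ` M"
  proof
    fix y assume yR: "y \<in> R"
    have "\<exists>x\<in>T ` M. dist x y < e" if e: "e > 0" for e
    proof -
      \<comment> \<open>The first bound keeps \<open>norm x\<close> below \<open>2 * c * norm y\<close>, the second makes \<open>T x\<close> close to \<open>y\<close>.\<close>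
      define b where "b = min (1 / (2 * c)) (e / (2 * c * norm y + 1))"
      have "2 * c * norm y + 1 > 0" using below(1) by (simp add: add_nonneg_pos)
      hence "b > 0" using below(1) e by (simp add: b_def)
      then obtain m where m: "cmod m < b" "bij (shift_op T m)"
        using lim by (auto simp: resolvent_limit_def)
      obtain z where z: "y = (T ^^ p) z" using yR by (auto simp: R_def)
      obtain u where u: "shift_op T m u = z" using surjD[OF bij_is_surj[OF m(2)], of z] by metis
      define x where "x = (T ^^ p) u"
      have xM: "x \<in> M" unfolding x_def M_def R_def by (rule subsetD[OF closure_subset]) (rule rangeI)
      have Tx: "T x - m *\<^sub>C x = y"
        using shift_funpow_commute[OF T, of m p u] u by (simp add: x_def z shift_op_def)
      have "norm (T x) \<le> norm y + cmod m * norm x"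
        using norm_triangle_ineq[of y "m *\<^sub>C x"] Tx by (auto simp: norm_scaleC algebra_simps)
      hence "norm x \<le> c * (norm y + cmod m * norm x)"
        using belowM[OF xM] below(1) by (meson mult_left_mono order_trans less_imp_le)
      moreover have "cmod m * c \<le> 1/2"
        using m(1) below(1) by (simp add: b_def field_simps)
      hence "(cmod m * c) * norm x \<le> 1/2 * norm x" by (rule mult_right_mono) simp
      ultimately have nx: "norm x \<le> 2 * c * norm y" by (simp add: algebra_simps)
      have "dist (T x) y = cmod m * norm x"
        by (simp add: dist_norm norm_scaleC flip: Tx)
      also have "\<dots> \<le> cmod m * (2 * c * norm y)" using nx by (intro mult_left_mono) auto
      also have "\<dots> \<le> cmod m * (2 * c * norm y + 1)" by (intro mult_left_mono) auto
      also have "\<dots> < e"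
        using m(1) \<open>2 * c * norm y + 1 > 0\<close> by (simp add: b_def pos_less_divide_eq)
      finally show ?thesis by (rule bexI[OF _ imageI[OF xM]])
    qed
    hence "y \<in> closure (T ` M)" by (simp add: closure_approachable)
    thus "y \<in> T ` M" using clTM by simp
  qed
  hence MT: "M \<subseteq> T ` M" unfolding M_def using clTM[unfolded M_def] by (rule closure_minimal)
  have Mn: "M \<subseteq> (T ^^ n) ` M" for n
  proof (induction n)
    case (Suc n)
    have "M \<subseteq> T ` ((T ^^ n) ` M)" using MT Suc by blast
    thus ?case by (simp add: image_comp)
  qed simp
  have "M \<subseteq> (T ^^ Suc p) ` M" by (rule Mn)
  moreover have "R \<subseteq> M" unfolding M_def by (rule closure_subset)
  ultimately have "R \<subseteq> range (T ^^ Suc p)" by blast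
  moreover have "kernel (T ^^ Suc p) \<subseteq> kernel (T ^^ p)"
  proof
    fix x assume "x \<in> kernel (T ^^ Suc p)"
    thus "x \<in> kernel (T ^^ p)" using below(2)[of x] by (simp add: kernel_def)
  qed
  ultimately show ?thesis by (simp add: drazin_at_def R_def)
qed

text \<open>The kernels of \<open>T ^^ p\<close> and \<open>T ^^ Suc p\<close> agree, so \<open>T ^^ p\<close> takes the same value at \<open>x\<close> and at the
controlled preimage that the open mapping theorem gives for \<open>(T ^^ Suc p) x\<close>.\<close>

lemma finite_ascent_closed_range_bounded_below:
  fixes T :: "'a::complex_banach \<Rightarrow> 'a"
  assumes T: "T \<in> bounded_ops" and asc: "kernel (T ^^ Suc p) \<subseteq> kernel (T ^^ p)"
    and cl: "closed (range (T ^^ Suc p))"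
  obtains c where "c > 0" "\<And>x. norm ((T ^^ p) x) \<le> c * norm ((T ^^ Suc p) x)"
proof -
  note Tp = funpow_bounded_ops[OF T, of p] and TS = funpow_bounded_ops[OF T, of "Suc p"]
  obtain k where k: "k > 0"
    "\<And>y. y \<in> range (T ^^ Suc p) \<Longrightarrow> \<exists>x\<in>UNIV. (T ^^ Suc p) x = y \<and> norm x \<le> k * norm y"
    using open_mapping_bound[OF bounded_opsD(1)[OF TS] closed_UNIV subspace_UNIV cl] by blast
  obtain K where K: "K > 0" "\<And>x. norm ((T ^^ p) x) \<le> norm x * K"
    using bounded_linear.pos_bounded[OF bounded_opsD(1)[OF Tp]] by blast
  show thesis
  proof (rule that[of "k * K"])
    fix x
    obtain u where u: "(T ^^ Suc p) u = (T ^^ Suc p) x" "norm u \<le> k * norm ((T ^^ Suc p) x)"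
      using k(2)[of "(T ^^ Suc p) x"] by blast
    have "x - u \<in> kernel (T ^^ Suc p)"
      unfolding kernel_def mem_Collect_eq bounded_opsD(4)[OF TS] u(1) by simp
    hence "x - u \<in> kernel (T ^^ p)" by (rule subsetD[OF asc])
    hence "(T ^^ p) x = (T ^^ p) u" by (simp add: kernel_def bounded_opsD(4)[OF Tp])
    hence "norm ((T ^^ p) x) \<le> norm u * K" using K(2)[of u] by simp
    also have "\<dots> \<le> (k * norm ((T ^^ Suc p) x)) * K"
      using u(2) K(1) by (intro mult_right_mono) auto
    also have "\<dots> = k * K * norm ((T ^^ Suc p) x)" by (simp only: mult_ac)
    finally show "norm ((T ^^ p) x) \<le> k * K * norm ((T ^^ Suc p) x)" .
  qed (use k K in simp)
qed

lemma drazin_if_finite_ascent: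
  fixes T :: "'a::complex_banach \<Rightarrow> 'a"
  assumes T: "T \<in> bounded_ops" and lim: "resolvent_limit T"
    and "kernel (T ^^ Suc p) \<subseteq> kernel (T ^^ p)" "closed (range (T ^^ Suc p))"
  shows "drazin_at T p"
  by (rule finite_ascent_closed_range_bounded_below[OF T assms(3,4)])
     (rule drazin_if_bounded_below[OF T lim])

text \<open>Here \<open>T\<close> maps the closed range of \<open>T ^^ p\<close> onto itself, and the persistence of kernel vectors makes
it injective there.\<close>

lemma drazin_if_finite_descent:
  fixes T :: "'a::complex_banach \<Rightarrow> 'a"
  assumes T: "T \<in> bounded_ops" and lim: "resolvent_limit T"
    and desc: "range (T ^^ p) \<subseteq> range (T ^^ Suc p)" and cl: "closed (range (T ^^ p))"
  shows "drazin_at T p"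
proof -
  have img: "T ` range (T ^^ p) = range (T ^^ p)"
    unfolding image_range_funpow using desc range_funpow_antimono[of p "Suc p" T] by auto
  have "kernel (T ^^ Suc p) \<subseteq> kernel (T ^^ p)"
  proof
    fix x assume "x \<in> kernel (T ^^ Suc p)"
    hence "T ((T ^^ p) x) = 0" by (simp add: kernel_def)
    hence "(T ^^ p) x = 0"
      using resolvent_limit_injective_on[OF T lim cl
          complex_subspace_range[OF funpow_bounded_ops[OF T]] img] by blast
    thus "x \<in> kernel (T ^^ p)" by (simp add: kernel_def)
  qed
  thus ?thesis using desc by (simp add: drazin_at_def)
qed

section \<open>Semi-Fredholm limits of resolvent points are Drazin invertible\<close>

text \<open>Enlarging \<open>E\<close> by the finite-dimensional kernel changes neither its closedness nor its image; for a
subspace containing the kernel, controlled preimages of a convergent sequence in the image approach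
a preimage of the limit.\<close>

lemma closed_image_if_finite_kernel:
  assumes T: "T \<in> bounded_ops" and ker: "finite_dim (kernel T)" and cl: "closed (range T)"
    and E: "closed E" "complex_vector.subspace E"
  shows "closed (T ` E)"
proof -
  obtain F where F: "finite F" "kernel T \<subseteq> complex_vector.span F" "F \<subseteq> kernel T"
    using finite_dim_basis[OF ker] by metis
  define E' where "E' = complex_vector.span (E \<union> F)"
  have E': "closed E'" "complex_vector.subspace E'" "kernel T \<subseteq> E'" "E \<subseteq> E'"
    using closed_span_Un_finite[OF F(1) E] F(2) complex_vector.span_mono[of F "E \<union> F"]
      complex_vector.span_superset[of "E \<union> F"]
    by (auto simp: E'_def)
  have "T ` E' = complex_vector.span (T ` E \<union> T ` F)"
    unfolding E'_def complex_pair.linear_span_image[OF complex_linear[OF T], symmetric] image_Un ..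
  also have "\<dots> \<subseteq> T ` E"
  proof (rule complex_vector.span_minimal[OF _ complex_subspace_image[OF T E(2)]])
    have "T ` F \<subseteq> {0}" using F(3) by (auto simp: kernel_def)
    also have "{0} \<subseteq> T ` E"
      using complex_vector.subspace_0[OF complex_subspace_image[OF T E(2)]] by simp
    finally show "T ` E \<union> T ` F \<subseteq> T ` E" by simp
  qed
  finally have img: "T ` E = T ` E'" using image_mono[OF E'(4), of T] by (rule_tac equalityI)
  obtain k where k: "k > 0" "\<And>y. y \<in> range T \<Longrightarrow> \<exists>x\<in>UNIV. T x = y \<and> norm x \<le> k * norm y"
    using open_mapping_bound[OF bounded_opsD(1)[OF T] closed_UNIV subspace_UNIV cl] by metis
  show ?thesis
    unfolding img closed_sequential_limits
  proof safe
    fix s y assume s: "\<forall>n. s n \<in> T ` E'" and lim: "s \<longlonglongrightarrow> y"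
    have "\<forall>n. s n \<in> range T" using s by blast
    hence "y \<in> range T" using closed_sequentially[OF cl _ lim] by blast
    then obtain x where x: "y = T x" by blast
    have "\<exists>e\<in>E'. dist e x < d" if d: "d > 0" for d
    proof -
      have "d / k > 0" using d k(1) by simp
      then obtain n where n: "dist (s n) y < d / k"
        using lim by (meson LIMSEQ_def order_refl)
      obtain e where e: "s n = T e" "e \<in> E'" using s by blast
      have "s n - y \<in> range T" using e x by (metis bounded_opsD(4)[OF T] rangeI)
      then obtain u where u: "T u = s n - y" "norm u \<le> k * norm (s n - y)" using k(2) by blast
      have "T (x + u - e) = 0" using u(1) e(1) x by (simp add: bounded_opsD[OF T])
      hence "x + u - e \<in> E'" using E'(3) by (auto simp: kernel_def)
      hence "x + u \<in> E'" using complex_vector.subspace_add[OF E'(2) _ e(2), of "x + u - e"] by simp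
      moreover have "norm u < d"
        using u(2) n k(1) by (simp add: dist_norm pos_less_divide_eq mult.commute)
      ultimately show ?thesis by (intro bexI[of _ "x + u"]) (auto simp: dist_norm)
    qed
    hence "x \<in> closure E'" by (simp add: closure_approachable)
    thus "y \<in> T ` E'" using E'(1) x by simp
  qed
qed

text \<open>The dimensions attain a minimum, from which on the chain is constant.\<close>

lemma finite_dim_chain_stabilizes:
  fixes K :: "nat \<Rightarrow> 'a::complex_banach set"
  assumes sub: "\<And>n. complex_vector.subspace (K n)" and dec: "\<And>m n. m \<le> n \<Longrightarrow> K n \<subseteq> K m"
    and fin: "finite_dim (K 0)"
  obtains p where "\<And>n. n \<ge> p \<Longrightarrow> K n = K p"
proof -
  have fin': "finite_dim (K n)" for n using finite_dim_subset[OF fin dec[of 0 n]] by simp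
  obtain p where p: "\<And>n. complex_vector.dim (K p) \<le> complex_vector.dim (K n)"
    using ex_has_least_nat[of "\<lambda>_. True" 0 "\<lambda>n. complex_vector.dim (K n)"] by auto
  show thesis
  proof (rule that[of p])
    fix n assume n: "n \<ge> p"
    obtain B where B: "finite B" "B \<subseteq> K n" "complex_vector.independent B" "K n \<subseteq> complex_vector.span B"
      by (rule finite_dim_basis[OF fin'])
    obtain D where D: "finite D" "D \<subseteq> K p" "complex_vector.independent D" "K p \<subseteq> complex_vector.span D"
      by (rule finite_dim_basis[OF fin'])
    have "K p \<subseteq> complex_vector.span B"
    proof
      fix x assume x: "x \<in> K p"
      show "x \<in> complex_vector.span B"
      proof (rule ccontr)
        assume nx: "x \<notin> complex_vector.span B"
        hence "complex_vector.independent (insert x B)"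
          using B(3) by (rule complex_vector.independent_insertI)
        moreover have "insert x B \<subseteq> complex_vector.span D" using x B(2) dec[OF n] D(4) by auto
        ultimately have "card (insert x B) \<le> card D"
          using complex_vector.independent_span_bound[OF D(1)] by blast
        moreover have "x \<notin> B" using nx complex_vector.span_base by blast
        ultimately have "card B < card D" using B(1) by simp
        moreover have "card B = complex_vector.dim (K n)" "card D = complex_vector.dim (K p)"
          using complex_vector.basis_card_eq_dim B D by blast+
        ultimately show False using p[of n] by simp
      qed
    qed
    also have "complex_vector.span B \<subseteq> K n" by (rule complex_vector.span_minimal[OF B(2) sub])
    finally show "K n = K p" using dec[OF n] by blast
  qed
qed

text \<open>All ranges of powers are closed, and the subspaces of the kernel that lie in them stabilize at some
\<open>p\<close>. Then \<open>T\<close> maps the intersection \<open>M\<close> of all these ranges onto itself, hence is injective on \<open>M\<close>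
by persistence of kernel vectors. But \<open>M\<close> contains every kernel vector in the range of \<open>T ^^ p\<close>, so
the ascent is at most \<open>p\<close>.\<close>

lemma drazin_if_upper_semi_Fredholm:
  assumes T: "T \<in> bounded_ops" and lim: "resolvent_limit T"
    and ker: "finite_dim (kernel T)" and cl: "closed (range T)"
  shows "drazin T"
proof -
  have clp: "closed (range (T ^^ n))" for n
  proof (induction n)
    case (Suc n)
    show ?case
      using closed_image_if_finite_kernel[OF T ker cl Suc complex_subspace_range[OF funpow_bounded_ops[OF T]]]
      unfolding image_range_funpow .
  qed simp
  define K where "K n = kernel T \<inter> range (T ^^ n)" for n
  have "complex_vector.subspace (K n)" for n
    unfolding K_def
    by (intro complex_vector.subspace_inter complex_subspace_kernel complex_subspace_range funpow_bounded_ops T)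
  moreover have "K n \<subseteq> K m" if "m \<le> n" for m n
    using range_funpow_antimono[OF that, of T] by (auto simp: K_def)
  moreover have "finite_dim (K 0)" using finite_dim_subset[OF ker] by (simp add: K_def)
  ultimately obtain p where p: "\<And>n. n \<ge> p \<Longrightarrow> K n = K p"
    using finite_dim_chain_stabilizes[of K] by metis
  define M where "M = (\<Inter>n. range (T ^^ n))"
  have M: "closed M" "complex_vector.subspace M"
    unfolding M_def
    using clp complex_subspace_range[OF funpow_bounded_ops[OF T]]
    by (auto intro!: closed_INT complex_vector.subspace_Inter)
  have "T ` M = M"
  proof
    show "T ` M \<subseteq> M"
    proof
      fix y assume "y \<in> T ` M"
      then obtain x where x: "x \<in> M" "y = T x" by blast
      have "y \<in> range (T ^^ n)" for n
      proof -
        have "y \<in> T ` range (T ^^ n)" using x by (auto simp: M_def)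
        thus ?thesis unfolding image_range_funpow using range_funpow_antimono[of n "Suc n" T] by auto
      qed
      thus "y \<in> M" by (simp add: M_def)
    qed
    show "M \<subseteq> T ` M"
    proof
      fix y assume y: "y \<in> M"
      have pre: "y \<in> T ` range (T ^^ n)" for n
        unfolding image_range_funpow using y unfolding M_def by blast
      then obtain x where x: "x \<in> range (T ^^ p)" "y = T x" by blast
      have "x \<in> range (T ^^ n)" if n: "n \<ge> p" for n
      proof -
        obtain x' where x': "x' \<in> range (T ^^ n)" "y = T x'" using pre[of n] by blast
        have "x - x' \<in> range (T ^^ p)"
          using x(1) x'(1) range_funpow_antimono[OF n, of T]
          by (intro complex_vector.subspace_diff complex_subspace_range funpow_bounded_ops T) auto
        hence "x - x' \<in> K p"
          using x(2) x'(2) by (simp add: K_def kernel_def bounded_opsD(4)[OF T])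
        hence "x - x' \<in> range (T ^^ n)" using p[OF n] by (auto simp: K_def)
        from complex_vector.subspace_add[OF complex_subspace_range[OF funpow_bounded_ops[OF T]] this x'(1)]
        show ?thesis by simp
      qed
      moreover have "x \<in> range (T ^^ n)" if "n \<le> p" for n
        using x(1) range_funpow_antimono[OF that, of T] by blast
      ultimately have "x \<in> M" unfolding M_def by (meson INT_I nle_le)
      thus "y \<in> T ` M" using x(2) by blast
    qed
  qed
  have "kernel (T ^^ Suc p) \<subseteq> kernel (T ^^ p)"
  proof
    fix x assume "x \<in> kernel (T ^^ Suc p)"
    hence Tx: "T ((T ^^ p) x) = 0" by (simp add: kernel_def)
    hence Kp: "(T ^^ p) x \<in> K p" by (simp add: K_def kernel_def)
    have "(T ^^ p) x \<in> range (T ^^ n)" for n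
    proof (cases "n \<ge> p")
      case True thus ?thesis using Kp p[of n] by (auto simp: K_def)
    next
      case False thus ?thesis using range_funpow_antimono[of n p T] by auto
    qed
    hence "(T ^^ p) x \<in> M" by (simp add: M_def)
    hence "(T ^^ p) x = 0"
      using resolvent_limit_injective_on[OF T lim M \<open>T ` M = M\<close> _ Tx] by blast
    thus "x \<in> kernel (T ^^ p)" by (simp add: kernel_def)
  qed
  from drazin_if_finite_ascent[OF T lim this clp] show ?thesis by (auto simp: drazin_def)
qed

text \<open>Each coefficient is bounded through the distance of its vector from the closed span of the others.\<close>

lemma independent_coefficient_bound:
  fixes V :: "'a::complex_banach set"
  assumes fin: "finite V" and ind: "complex_vector.independent V"
  obtains K where "K > 0" "\<And>c. (\<Sum>v\<in>V. cmod (c v)) \<le> K * norm (\<Sum>v\<in>V. c v *\<^sub>C v)"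
proof -
  have "\<exists>d>0. \<forall>e\<in>complex_vector.span (V - {u}). d \<le> norm (u - e)" if u: "u \<in> V" for u
  proof -
    have "u \<notin> complex_vector.span (V - {u})"
      using ind u unfolding complex_vector.dependent_def by blast
    thus ?thesis
      using distance_to_closed_subspace[OF closed_span_finite[of "V - {u}"]] fin by (metis finite_Diff)
  qed
  then obtain d where d: "\<And>u. u \<in> V \<Longrightarrow> d u > 0"
    "\<And>u e. u \<in> V \<Longrightarrow> e \<in> complex_vector.span (V - {u}) \<Longrightarrow> d u \<le> norm (u - e)" by metis
  have one: "cmod (c u) \<le> inverse (d u) * norm (\<Sum>v\<in>V. c v *\<^sub>C v)" if u: "u \<in> V" for u c
  proof (cases "c u = 0")
    case True
    thus ?thesis using d(1)[OF u] by simp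
  next
    case False
    define e where "e = (\<Sum>v\<in>V-{u}. (- inverse (c u) * c v) *\<^sub>C v)"
    have "e \<in> complex_vector.span (V - {u})"
      unfolding e_def
      by (intro complex_vector.span_sum complex_vector.span_scale complex_vector.span_base)
    hence "d u \<le> norm (u - e)" by (rule d(2)[OF u])
    moreover have "c u *\<^sub>C (u - e) = (\<Sum>v\<in>V. c v *\<^sub>C v)"
    proof -
      have "c u *\<^sub>C e = (\<Sum>v\<in>V-{u}. - (c v *\<^sub>C v))"
        unfolding e_def complex_vector.scale_sum_right using False
        by (intro sum.cong) (auto simp: scaleC_scaleC)
      also have "\<dots> = - (\<Sum>v\<in>V-{u}. c v *\<^sub>C v)" by (rule sum_negf)
      finally have ce: "c u *\<^sub>C e = - (\<Sum>v\<in>V-{u}. c v *\<^sub>C v)" .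
      show ?thesis
        unfolding complex_vector.scale_right_diff_distrib ce sum.remove[OF fin u] by simp
    qed
    ultimately have "cmod (c u) * d u \<le> norm (\<Sum>v\<in>V. c v *\<^sub>C v)"
      by (metis mult_left_mono norm_ge_zero norm_scaleC)
    thus ?thesis using d(1)[OF u] by (simp add: field_simps)
  qed
  show thesis
  proof (rule that[of "(\<Sum>u\<in>V. inverse (d u)) + 1"])
    have "(\<Sum>u\<in>V. inverse (d u)) \<ge> 0" using d(1) by (intro sum_nonneg) (simp add: less_imp_le)
    thus "(\<Sum>u\<in>V. inverse (d u)) + 1 > 0" by simp
    fix c :: "'a \<Rightarrow> complex"
    have "(\<Sum>v\<in>V. cmod (c v)) \<le> (\<Sum>u\<in>V. inverse (d u) * norm (\<Sum>v\<in>V. c v *\<^sub>C v))"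
      by (rule sum_mono) (rule one)
    thus "(\<Sum>v\<in>V. cmod (c v)) \<le> ((\<Sum>u\<in>V. inverse (d u)) + 1) * norm (\<Sum>v\<in>V. c v *\<^sub>C v)"
      unfolding distrib_right sum_distrib_right mult_1 by (rule add_increasing2[rotated]) simp
  qed
qed

text \<open>A linear relation among the perturbed vectors would give a combination of the original ones that is
too small for its coefficients.\<close>

lemma independent_perturbation:
  fixes V :: "'a::complex_banach set"
  assumes fin: "finite V" and ind: "complex_vector.independent V"
  shows "\<exists>e>0. \<forall>z. (\<forall>v\<in>V. norm (v - z v) \<le> e) \<longrightarrow>
    inj_on z V \<and> complex_vector.independent (z ` V)"
proof -
  obtain K where K: "K > 0" "\<And>c. (\<Sum>v\<in>V. cmod (c v)) \<le> K * norm (\<Sum>v\<in>V. c v *\<^sub>C v)"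
    by (rule independent_coefficient_bound[OF fin ind]) (rule that)
  show ?thesis
  proof (intro exI[of _ "1 / (2 * K)"] conjI[of "_ < _"] allI impI)
    show "0 < 1 / (2 * K)" using K(1) by simp
    fix z :: "'a \<Rightarrow> 'a" assume "\<forall>v\<in>V. norm (v - z v) \<le> 1 / (2 * K)"
    hence z: "norm (v - z v) \<le> 1 / (2 * K)" if "v \<in> V" for v using that by blast
    have triv: "c v = 0" if c: "(\<Sum>v\<in>V. c v *\<^sub>C z v) = 0" and v: "v \<in> V" for c v
    proof -
      define S where "S = (\<Sum>v\<in>V. cmod (c v))"
      have "(\<Sum>v\<in>V. c v *\<^sub>C v) = (\<Sum>v\<in>V. c v *\<^sub>C (v - z v))"
        using c by (simp add: complex_vector.scale_right_diff_distrib sum_subtractf)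
      also have "norm \<dots> \<le> (\<Sum>v\<in>V. cmod (c v) * (1 / (2 * K)))"
        by (rule sum_norm_le) (unfold norm_scaleC, rule mult_left_mono[OF z norm_ge_zero])
      finally have "norm (\<Sum>v\<in>V. c v *\<^sub>C v) \<le> S / (2 * K)"
        by (simp add: S_def sum_divide_distrib)
      hence "K * norm (\<Sum>v\<in>V. c v *\<^sub>C v) \<le> K * (S / (2 * K))" using K(1) by (intro mult_left_mono) auto
      also have "\<dots> = S / 2" using K(1) by simp
      finally have "S \<le> S / 2" using K(2)[of c] unfolding S_def by linarith
      hence "S \<le> 0" by simp
      moreover have "cmod (c v) \<le> S" unfolding S_def by (rule member_le_sum[OF v _ fin]) auto
      ultimately have "cmod (c v) \<le> 0" by (rule order_trans[rotated])
      thus "c v = 0" by simp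
    qed
    have inj: "inj_on z V"
    proof (rule inj_onI, rule ccontr)
      fix u v assume uv: "u \<in> V" "v \<in> V" "z u = z v" "u \<noteq> v"
      define c where "c w = (if w = u then 1 else if w = v then - 1 else (0::complex))" for w
      have "(\<Sum>w\<in>V. c w *\<^sub>C z w) = (\<Sum>w\<in>{u, v}. c w *\<^sub>C z w)"
        using uv fin by (intro sum.mono_neutral_right) (auto simp: c_def)
      also have "\<dots> = 0" using uv by (simp add: c_def scaleC_one)
      finally have "c u = 0" using uv(1) by (rule triv)
      thus False by (simp add: c_def)
    qed
    moreover have "complex_vector.independent (z ` V)"
    proof (rule complex_vector.independent_if_scalars_zero)
      fix f y assume f: "(\<Sum>x\<in>z ` V. f x *\<^sub>C x) = 0" and "y \<in> z ` V"
      then obtain v where v: "v \<in> V" "y = z v" by blast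
      have "(\<Sum>v\<in>V. f (z v) *\<^sub>C z v) = 0" using f by (simp add: sum.reindex[OF inj])
      hence "f (z v) = 0" using v(1) by (rule triv[of "\<lambda>v. f (z v)"])
      thus "f y = 0" using v by simp
    qed (use fin in simp)
    ultimately show "inj_on z V \<and> complex_vector.independent (z ` V)" ..
  qed
qed

text \<open>A substitute for the stability of the index. Let \<open>W\<close> be a complement of the range with a basis of
\<open>n\<close> vectors. If the kernel contained \<open>n + 1\<close> independent vectors, small corrections (solving a
perturbed surjective equation) would move them into the preimage of \<open>W\<close> under a bijective \<open>T - m\<close>,
a space of dimension at most \<open>n\<close>, without destroying independence.\<close>

lemma lower_semi_Fredholm_imp_upper:
  assumes T: "T \<in> bounded_ops" and lim: "resolvent_limit T"
    and F: "finite F" "complex_vector.span (range T \<union> F) = UNIV"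
  shows "finite_dim (kernel T)" "closed (range T)"
proof -
  obtain G where G: "finite G" "\<And>x. x \<in> range T \<Longrightarrow> x \<in> complex_vector.span G \<Longrightarrow> x = 0"
    "complex_vector.span (range T \<union> G) = complex_vector.span (range T \<union> F)"
    by (rule finite_complement[OF complex_subspace_range[OF T] F(1)]) (rule that)
  define W where "W = complex_vector.span G"
  have W: "closed W" "complex_vector.subspace W"
    unfolding W_def by (rule closed_span_finite[OF G(1)]) (rule complex_vector.subspace_span)
  note subW = complex_subspace_imp_subspace[OF W(2)]
  have cover: "\<exists>x. y - T x \<in> W" for y
  proof -
    have "y \<in> complex_vector.span (range T \<union> G)" using F G by simp
    then obtain a b where "a \<in> complex_vector.span (range T)" and b: "b \<in> W" "y = a + b"
      unfolding complex_vector.span_Un W_def by blast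
    moreover have "complex_vector.span (range T) = range T"
      using complex_subspace_range[OF T] by (simp add: complex_vector.span_eq_iff[THEN iffD2])
    ultimately obtain x where "a = T x" by blast
    thus ?thesis using b by (intro exI[of _ x]) simp
  qed
  show "closed (range T)"
    by (rule closed_range_if_closed_complement[OF bounded_opsD(1)[OF T] W(1) subW _ cover])
      (use G(2) in \<open>auto simp: W_def\<close>)
  define g where "g p = T (fst p) + snd p" for p :: "'a \<times> 'a"
  have g: "bounded_linear g"
    unfolding g_def
    by (intro bounded_linear_add bounded_linear_compose[OF bounded_opsD(1)[OF T]]
        bounded_linear_fst bounded_linear_snd)
  have E: "closed (UNIV \<times> W)" "subspace (UNIV \<times> W)"
    using W(1) subW by (auto intro!: closed_Times subspace_Times)
  have gU: "g ` (UNIV \<times> W) = UNIV"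
  proof -
    have "y \<in> g ` (UNIV \<times> W)" for y
    proof -
      obtain x where "y - T x \<in> W" using cover by blast
      thus ?thesis by (intro image_eqI[of _ _ "(x, y - T x)"]) (auto simp: g_def)
    qed
    thus ?thesis by auto
  qed
  obtain k where k: "k > 0"
    "\<And>y. y \<in> g ` (UNIV \<times> W) \<Longrightarrow> \<exists>p\<in>UNIV \<times> W. g p = y \<and> norm p \<le> k * norm y"
    by (rule open_mapping_bound[OF g E]) (use gU in \<open>auto intro: that\<close>)
  show "finite_dim (kernel T)"
  proof (rule ccontr)
    assume infin: "\<not> finite_dim (kernel T)"
    obtain B where B: "B \<subseteq> kernel T" "complex_vector.independent B" "kernel T \<subseteq> complex_vector.span B"
      by (rule complex_vector.maximal_independent_subset)
    have "infinite B" using infin B(3) unfolding finite_dim_def by blast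
    then obtain V where V: "V \<subseteq> B" "finite V" "card V = Suc (card G)"
      using infinite_arbitrarily_large by metis
    have indV: "complex_vector.independent V" by (rule complex_vector.independent_mono[OF B(2) V(1)])
    obtain e where e: "e > 0" "\<forall>z. (\<forall>v\<in>V. norm (v - z v) \<le> e) \<longrightarrow>
        inj_on z V \<and> complex_vector.independent (z ` V)"
      using independent_perturbation[OF V(2) indV] by blast
    define N where "N = (\<Sum>v\<in>V. norm v)"
    have N: "N \<ge> 0" "\<And>v. v \<in> V \<Longrightarrow> norm v \<le> N"
      unfolding N_def by (auto intro: sum_nonneg member_le_sum V(2))
    \<comment> \<open>The first bound permits the perturbation argument, the second keeps the corrections below \<open>e\<close>.\<close>
    define b where "b = min (1 / (2 * k)) (e / (2 * k * N + 1))"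
    have pos: "2 * k * N + 1 > 0" using k(1) N(1) by (simp add: add_nonneg_pos)
    hence "b > 0" using k(1) e(1) by (simp add: b_def)
    then obtain m where m: "cmod m < b" "bij (shift_op T m)"
      using lim by (auto simp: resolvent_limit_def)
    have mk: "cmod m * k \<le> 1/2" using m(1) k(1) by (simp add: b_def field_simps)
    have "\<exists>w. shift_op T m (v + w) \<in> W \<and> norm w \<le> e" if v: "v \<in> V" for v
    proof -
      \<comment> \<open>Solving this equation amounts to \<open>(T - m) (v + w) \<in> W\<close>, since \<open>T v = 0\<close>.\<close>
      have "\<exists>p\<in>UNIV \<times> W. g p - m *\<^sub>C fst p = m *\<^sub>C v \<and> norm p \<le> 2 * k * norm (m *\<^sub>C v)"
      proof (rule perturbed_surjection[OF g _ _ _ E subspace_UNIV])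
        show "bounded_linear (\<lambda>p :: 'a \<times> 'a. m *\<^sub>C fst p)"
          by (intro bounded_linear_compose[OF bounded_linear_scaleC] bounded_linear_fst)
        show "norm (m *\<^sub>C fst p) \<le> cmod m * norm p" for p :: "'a \<times> 'a"
          by (cases p) (auto simp: norm_scaleC intro!: mult_left_mono norm_fst_le)
        show "\<exists>p\<in>UNIV \<times> W. g p = y \<and> norm p \<le> k * norm y" for y
          using k(2)[of y] gU by simp
      qed (use k(1) mk in auto)
      then obtain w f where wf: "f \<in> W" "T w + f - m *\<^sub>C w = m *\<^sub>C v" "norm (w, f) \<le> 2 * k * norm (m *\<^sub>C v)"
        by (auto simp: g_def)
      have "T v = 0" using v V(1) B(1) by (auto simp: kernel_def)
      hence "shift_op T m (v + w) = - f"
        using wf(2) by (simp add: shift_op_def bounded_opsD(3)[OF T] scaleC_add_right algebra_simps)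
      moreover have "- f \<in> W" using wf(1) W(2) by (rule_tac complex_vector.subspace_neg)
      moreover have "norm w \<le> e"
      proof -
        have "norm w \<le> 2 * k * norm (m *\<^sub>C v)" using wf(3) norm_fst_le[of w f] by simp
        also have "\<dots> = cmod m * (2 * k * norm v)" by (simp add: norm_scaleC)
        also have "\<dots> \<le> cmod m * (2 * k * N + 1)"
          using N(2)[OF v] k(1) by (intro mult_left_mono) (auto intro!: mult_left_mono add_increasing2)
        also have "\<dots> \<le> e" using m(1) pos by (simp add: b_def pos_less_divide_eq less_imp_le)
        finally show ?thesis .
      qed
      ultimately show ?thesis by metis
    qed
    then obtain w where w: "\<And>v. v \<in> V \<Longrightarrow> shift_op T m (v + w v) \<in> W"
      "\<And>v. v \<in> V \<Longrightarrow> norm (w v) \<le> e" by metis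
    define z where "z v = v + w v" for v
    have z: "inj_on z V" "complex_vector.independent (z ` V)"
      using e(2)[rule_format, of z] w(2) by (auto simp: z_def)
    note S = shift_bounded_ops[OF T, of m]
    have "shift_op T m ` z ` V \<subseteq> W" using w(1) by (auto simp: z_def)
    moreover have "complex_vector.independent (shift_op T m ` z ` V)"
      using z(2) complex_pair.linear_independent_injective_image[OF complex_linear[OF S]]
        bij_is_inj[OF m(2)] by (auto intro: inj_on_subset)
    ultimately have "card (shift_op T m ` z ` V) \<le> card G"
      using complex_vector.independent_span_bound[OF G(1)] unfolding W_def by blast
    moreover have "card (shift_op T m ` z ` V) = card V"
      using card_image[OF inj_on_subset[OF bij_is_inj[OF m(2)] subset_UNIV]] card_image[OF z(1)] by metis
    ultimately show False using V(3) by simp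
  qed
qed

lemma drazin_if_lower_semi_Fredholm:
  assumes "T \<in> bounded_ops" "resolvent_limit T"
    and "finite F" "complex_vector.span (range T \<union> F) = UNIV"
  shows "drazin T"
  using drazin_if_upper_semi_Fredholm[OF assms(1,2) lower_semi_Fredholm_imp_upper[OF assms]] .

lemma finite_kernel_funpow:
  fixes T :: "'a::complex_banach \<Rightarrow> 'a"
  assumes T: "T \<in> bounded_ops" and ker: "finite_dim (kernel T)"
  shows "finite_dim (kernel (T ^^ p))"
proof (induction p)
  case 0
  have "kernel (T ^^ 0) \<subseteq> kernel T" by (auto simp: kernel_def bounded_opsD(5)[OF T])
  thus ?case by (rule finite_dim_subset[OF ker])
next
  case (Suc p)
  have img: "T ` kernel (T ^^ Suc p) \<subseteq> kernel (T ^^ p)"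
    by (auto simp: kernel_def funpow_swap1)
  show ?case
  proof (rule finite_dim_if_image_and_kernel[OF _ T])
    show "complex_vector.subspace (kernel (T ^^ Suc p))"
      by (intro complex_subspace_kernel funpow_bounded_ops T)
    show "finite_dim (T ` kernel (T ^^ Suc p))" by (rule finite_dim_subset[OF Suc img])
    show "finite_dim (kernel (T ^^ Suc p) \<inter> kernel T)" by (rule finite_dim_subset[OF ker Int_lower2])
  qed
qed

section \<open>The operator classes near resolvent points\<close>

definition cofinite_range :: "('a::complex_banach \<Rightarrow> 'a) \<Rightarrow> bool"
  where "cofinite_range T \<longleftrightarrow> (\<exists>F. finite F \<and> complex_vector.span (range T \<union> F) = UNIV)"

text \<open>A common weakening of all the regularity conditions that define the six spectra.\<close>

definition admissible :: "('a::complex_banach \<Rightarrow> 'a) \<Rightarrow> bool"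
  where "admissible T \<longleftrightarrow> T \<in> R9 \<or> T \<in> R4 \<or>
    finite_dim (kernel T) \<and> closed (range T) \<or> cofinite_range T"

lemma nullity_finite_iff: "nullity T < \<infinity> \<longleftrightarrow> finite_dim (kernel T)"
  by (simp add: nullity_def edim_def)

lemma nullity_eq_0_iff:
  assumes T: "T \<in> bounded_ops"
  shows "nullity T = 0 \<longleftrightarrow> (\<forall>x. T x = 0 \<longrightarrow> x = 0)"
proof
  assume "nullity T = 0"
  hence fin: "finite_dim (kernel T)" and dim: "complex_vector.dim (kernel T) = 0"
    by (auto simp: nullity_def edim_def zero_enat_def split: if_splits)
  obtain B where B: "finite B" "B \<subseteq> kernel T" "complex_vector.independent B" "kernel T \<subseteq> complex_vector.span B"
    by (rule finite_dim_basis[OF fin])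
  have "card B = 0" using complex_vector.basis_card_eq_dim[OF B(2,4,3)] dim by simp
  hence "kernel T \<subseteq> {0}" using B(1,4) by simp
  thus "\<forall>x. T x = 0 \<longrightarrow> x = 0" by (auto simp: kernel_def)
next
  assume "\<forall>x. T x = 0 \<longrightarrow> x = 0"
  hence sub: "kernel T \<subseteq> complex_vector.span {}" by (auto simp: kernel_def)
  hence "finite_dim (kernel T)" unfolding finite_dim_def by blast
  moreover have "complex_vector.dim (kernel T) \<le> 0"
    using complex_vector.dim_le_card[OF sub] by simp
  ultimately show "nullity T = 0" by (simp add: nullity_def edim_def zero_enat_def)
qed

lemma independent_mod_insert:
  assumes S: "complex_vector.subspace S" and F: "finite F" "independent_mod S F"
    and x: "x \<notin> complex_vector.span (S \<union> F)"
  shows "independent_mod S (insert x F)"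
  unfolding independent_mod_def
proof (intro allI impI)
  fix c :: "'a \<Rightarrow> complex"
  assume sum: "(\<Sum>b\<in>insert x F. c b *\<^sub>C b) \<in> S"
  have xF: "x \<notin> F" using x complex_vector.span_base by blast
  define s where "s = (\<Sum>b\<in>F. c b *\<^sub>C b)"
  have cs: "c x *\<^sub>C x + s \<in> S" using sum F(1) xF by (simp add: s_def)
  have "c x = 0"
  proof (rule ccontr)
    assume c: "c x \<noteq> 0"
    have "c x *\<^sub>C x + s \<in> complex_vector.span (S \<union> F)" using cs by (intro complex_vector.span_base) simp
    moreover have "s \<in> complex_vector.span (S \<union> F)"
      unfolding s_def by (intro complex_vector.span_sum complex_vector.span_scale complex_vector.span_base) simp
    ultimately have "c x *\<^sub>C x + s - s \<in> complex_vector.span (S \<union> F)" by (rule complex_vector.span_diff)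
    hence "inverse (c x) *\<^sub>C (c x *\<^sub>C x + s - s) \<in> complex_vector.span (S \<union> F)"
      by (rule complex_vector.span_scale)
    moreover have "inverse (c x) *\<^sub>C (c x *\<^sub>C x + s - s) = x" using c by (simp add: scaleC_scaleC scaleC_one)
    ultimately show False using x by simp
  qed
  moreover from this have "s \<in> S" using cs by simp
  hence "\<forall>b\<in>F. c b = 0" using F(2) unfolding independent_mod_def s_def by blast
  ultimately show "\<forall>b\<in>insert x F. c b = 0" by simp
qed

lemma card_le_quotient_dim:
  "finite F \<Longrightarrow> independent_mod S F \<Longrightarrow> enat (card F) \<le> quotient_dim S"
  unfolding quotient_dim_def by (rule SUP_upper) simp

text \<open>A largest finite set that is independent modulo \<open>S\<close> spans the whole space together with \<open>S\<close>.\<close>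

lemma finite_quotient_dim_span:
  assumes S: "complex_vector.subspace S" and fin: "quotient_dim S < \<infinity>"
  shows "\<exists>F. finite F \<and> enat (card F) \<le> quotient_dim S \<and> complex_vector.span (S \<union> F) = UNIV"
proof -
  obtain N where N: "quotient_dim S = enat N" using fin by auto
  let ?P = "\<lambda>F. finite F \<and> independent_mod S F"
  have "?P {}" by (simp add: independent_mod_def)
  moreover have bound: "card F \<le> N" if "?P F" for F using card_le_quotient_dim[of F S] that N by simp
  ultimately obtain F where F: "?P F" "\<And>G. ?P G \<Longrightarrow> card G \<le> card F"
    using ex_has_greatest_nat[of ?P "{}" card "Suc N"] by (metis (no_types, lifting) le_imp_less_Suc)
  have "x \<in> complex_vector.span (S \<union> F)" for x
  proof (rule ccontr)
    assume x: "x \<notin> complex_vector.span (S \<union> F)"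
    hence "card (insert x F) \<le> card F" using F independent_mod_insert[OF S _ _ x] by simp
    moreover have "x \<notin> F" using x complex_vector.span_base by blast
    ultimately show False using F(1) by simp
  qed
  thus ?thesis using F(1) card_le_quotient_dim by blast
qed

lemma finite_deficiency_cofinite_range:
  assumes "T \<in> bounded_ops" "deficiency T < \<infinity>" shows "cofinite_range T"
  using finite_quotient_dim_span[OF complex_subspace_range[OF assms(1)]] assms(2)
  unfolding deficiency_def cofinite_range_def by blast

lemma deficiency_0_surj:
  assumes "T \<in> bounded_ops" "deficiency T = 0" shows "surj T"
proof -
  obtain F where "finite F" "enat (card F) \<le> 0" "complex_vector.span (range T \<union> F) = UNIV"
    using finite_quotient_dim_span[OF complex_subspace_range[OF assms(1)]] assms(2)
    unfolding deficiency_def by auto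
  thus ?thesis
    using complex_subspace_range[OF assms(1)]
    by (simp add: zero_enat_def complex_vector.span_eq_iff[THEN iffD2])
qed

lemma ascent_finiteD:
  assumes "ascent T < \<infinity>"
  shows "kernel (T ^^ Suc (the_enat (ascent T))) \<subseteq> kernel (T ^^ the_enat (ascent T))"
proof -
  have ex: "\<exists>k. kernel (T ^^ k) = kernel (T ^^ (k + 1))" using assms by (auto simp: ascent_def split: if_splits)
  hence "the_enat (ascent T) = (LEAST k. kernel (T ^^ k) = kernel (T ^^ (k + 1)))" by (simp add: ascent_def)
  thus ?thesis using LeastI_ex[OF ex] by simp
qed

lemma descent_finiteD:
  assumes "descent T < \<infinity>"
  shows "range (T ^^ the_enat (descent T)) \<subseteq> range (T ^^ Suc (the_enat (descent T)))"
proof -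
  have ex: "\<exists>k. range (T ^^ k) = range (T ^^ (k + 1))" using assms by (auto simp: descent_def split: if_splits)
  hence "the_enat (descent T) = (LEAST k. range (T ^^ k) = range (T ^^ (k + 1)))" by (simp add: descent_def)
  thus ?thesis using LeastI_ex[OF ex] by simp
qed

text \<open>The common core of all six cases: near the resolvent set, one-sided regularity is two-sided.\<close>

lemma admissible_imp_drazin:
  assumes T: "T \<in> bounded_ops" and lim: "resolvent_limit T" and "admissible T"
  shows "drazin T"
  using assms(3) unfolding admissible_def
proof (elim disjE conjE)
  assume "T \<in> R9"
  hence "ascent T < \<infinity>" "closed (range (T ^^ Suc (the_enat (ascent T))))" by (auto simp: R9_def)
  thus ?thesis using drazin_if_finite_ascent[OF T lim ascent_finiteD] unfolding drazin_def by blast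
next
  assume "T \<in> R4"
  hence "descent T < \<infinity>" "closed (range (T ^^ the_enat (descent T)))" by (auto simp: R4_def)
  thus ?thesis using drazin_if_finite_descent[OF T lim descent_finiteD] unfolding drazin_def by blast
next
  assume "cofinite_range T"
  thus ?thesis using drazin_if_lower_semi_Fredholm[OF T lim] unfolding cofinite_range_def by blast
qed (rule drazin_if_upper_semi_Fredholm[OF T lim])

text \<open>The least exponent \<open>a\<close> at which the kernels stabilize is also one at which the ranges have
stabilized, so closedness of the range holds at \<open>a + 1\<close> and not only at the given \<open>p\<close>.\<close>

lemma drazin_imp_R9:
  assumes T: "T \<in> bounded_ops" and "drazin T"
  shows "T \<in> R9"
proof -
  obtain p where p: "drazin_at T p" using assms(2) by (auto simp: drazin_def)
  have keq: "kernel (T ^^ p) = kernel (T ^^ (p + 1))"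
    using drazin_atD(1)[OF p] kernel_funpow_mono[OF T, of p "p + 1"] by simp
  define a where "a = (LEAST k. kernel (T ^^ k) = kernel (T ^^ (k + 1)))"
  have a: "kernel (T ^^ a) = kernel (T ^^ Suc a)" "a \<le> p"
    unfolding a_def using LeastI[of "\<lambda>k. kernel (T ^^ k) = kernel (T ^^ (k + 1))", OF keq]
      Least_le[of "\<lambda>k. kernel (T ^^ k) = kernel (T ^^ (k + 1))", OF keq] by simp_all
  have asc: "ascent T = enat a" using keq unfolding ascent_def a_def by auto
  have "range (T ^^ a) \<subseteq> range (T ^^ Suc a)"
  proof
    fix y assume "y \<in> range (T ^^ a)"
    then obtain x where x: "y = (T ^^ a) x" by blast
    obtain z where "(T ^^ p) (x - (T ^^ p) z) = 0" using drazin_split[OF T p] by blast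
    hence "(T ^^ (a + (p - a))) (x - (T ^^ p) z) = 0" using a(2) by simp
    hence "(T ^^ a) (x - (T ^^ p) z) = 0" using a(1) by (intro kernel_funpow_stable[of a T]) auto
    hence "y = (T ^^ a) ((T ^^ p) z)" by (simp add: x bounded_opsD(4)[OF funpow_bounded_ops[OF T]])
    also obtain u where "(T ^^ p) z = (T ^^ Suc p) u" using drazin_atD(2)[OF p] by blast
    hence "(T ^^ a) ((T ^^ p) z) = (T ^^ Suc a) ((T ^^ p) u)" by (simp add: funpow_swap1)
    finally show "y \<in> range (T ^^ Suc a)" by blast
  qed
  hence "drazin_at T a" using a(1) by (simp add: drazin_at_def)
  hence "closed (range (T ^^ Suc a))" using drazin_closed_range[OF T drazin_at_mono[OF T, of a "Suc a"]] by simp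
  thus ?thesis using T asc by (simp add: R9_def)
qed

lemma drazin_imp_R4:
  assumes T: "T \<in> bounded_ops" and "drazin T"
  shows "T \<in> R4"
proof -
  obtain p where p: "drazin_at T p" using assms(2) by (auto simp: drazin_def)
  have req: "range (T ^^ p) = range (T ^^ (p + 1))"
    using drazin_atD(2)[OF p] range_funpow_antimono[of p "p + 1" T] by simp
  define b where "b = (LEAST k. range (T ^^ k) = range (T ^^ (k + 1)))"
  have b: "range (T ^^ b) = range (T ^^ Suc b)" "b \<le> p"
    unfolding b_def using LeastI[of "\<lambda>k. range (T ^^ k) = range (T ^^ (k + 1))", OF req]
      Least_le[of "\<lambda>k. range (T ^^ k) = range (T ^^ (k + 1))", OF req] by simp_all
  have desc: "descent T = enat b" using req unfolding descent_def b_def by auto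
  have "range (T ^^ b) \<subseteq> range (T ^^ p)"
  proof
    fix y assume "y \<in> range (T ^^ b)"
    then obtain x where "y = (T ^^ b) x" by blast
    moreover obtain z where "(T ^^ b) x = (T ^^ (b + (p - b))) z"
      using range_funpow_stable[of b T x "p - b"] b(1) by blast
    ultimately show "y \<in> range (T ^^ p)" using b(2) by simp
  qed
  hence "range (T ^^ b) = range (T ^^ p)" using range_funpow_antimono[OF b(2), of T] by blast
  thus ?thesis using T desc drazin_closed_range[OF T p] by (simp add: R4_def)
qed

lemma bij_imp_drazin:
  assumes "T \<in> bounded_ops" "bij T" shows "drazin T"
proof -
  have "drazin_at T 0"
    using bij_bounded_opsD[OF assms] bij_is_surj[OF assms(2)]
    by (auto simp: drazin_at_def kernel_def)
  thus ?thesis unfolding drazin_def by blast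
qed

lemma drazin_injective_imp_bij:
  assumes T: "T \<in> bounded_ops" "drazin T" and inj: "\<And>x. T x = 0 \<Longrightarrow> x = 0"
  shows "bij T"
proof (rule bounded_ops_bijI[OF T(1) inj])
  fix y
  obtain p where p: "drazin_at T p" using T(2) by (auto simp: drazin_def)
  obtain z where z: "(T ^^ p) y = (T ^^ Suc p) z" using drazin_atD(2)[OF p] by blast
  have injp: "(T ^^ n) x = 0 \<Longrightarrow> x = 0" for n x by (induction n) (auto dest: inj)
  have "(T ^^ p) (T z - y) = 0"
    using z by (simp add: bounded_opsD(4)[OF funpow_bounded_ops[OF T(1)]] funpow_swap1)
  hence "T z = y" using injp[of p "T z - y"] by simp
  thus "\<exists>x. T x = y" ..
qed

lemma drazin_surjective_imp_bij:
  assumes T: "T \<in> bounded_ops" "drazin T" and surj: "surj T"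
  shows "bij T"
proof (rule bounded_ops_bijI[OF T(1)])
  fix x assume x: "T x = 0"
  obtain p where p: "drazin_at T p" using T(2) by (auto simp: drazin_def)
  obtain y where y: "x = (T ^^ p) y" using surj_fn[OF surj, of p] by (metis surjD)
  hence "y \<in> kernel (T ^^ Suc p)" using x by (simp add: kernel_def)
  hence "y \<in> kernel (T ^^ p)" using drazin_atD(1)[OF p] by blast
  thus "x = 0" using y by (simp add: kernel_def)
next
  show "\<exists>x. T x = y" for y using surj by (metis surjD)
qed

lemma drazin_finite_kernel_cofinite_range:
  assumes T: "T \<in> bounded_ops" "drazin T" "finite_dim (kernel T)"
  shows "cofinite_range T"
proof -
  obtain p where "drazin_at T p" using T(2) by (auto simp: drazin_def)
  \<comment> \<open>A positive exponent, so that the range of the power is contained in the range of \<open>T\<close>.\<close>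
  hence p: "drazin_at T (Suc p)" using drazin_at_mono[OF T(1), of p "Suc p"] by simp
  obtain F where F: "finite F" "kernel (T ^^ Suc p) \<subseteq> complex_vector.span F"
    using finite_kernel_funpow[OF T(1,3), of "Suc p"] by (auto simp: finite_dim_def)
  have "y \<in> complex_vector.span (range T \<union> F)" for y
  proof -
    obtain z where "(T ^^ Suc p) (y - (T ^^ Suc p) z) = 0" using drazin_split[OF T(1) p] by blast
    hence "y - (T ^^ Suc p) z \<in> complex_vector.span (range T \<union> F)"
      using F(2) complex_vector.span_mono[of F "range T \<union> F"] by (auto simp: kernel_def)
    moreover have "(T ^^ Suc p) z \<in> complex_vector.span (range T \<union> F)"
      by (intro complex_vector.span_base) simp
    ultimately have "y - (T ^^ Suc p) z + (T ^^ Suc p) z \<in> complex_vector.span (range T \<union> F)"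
      by (rule complex_vector.span_add)
    thus ?thesis by simp
  qed
  thus ?thesis using F(1) unfolding cofinite_range_def by blast
qed

lemma cofinite_range_finite_kernel:
  assumes "T \<in> bounded_ops" "resolvent_limit T" "cofinite_range T"
  shows "finite_dim (kernel T)" "closed (range T)"
  using assms(3) lower_semi_Fredholm_imp_upper[OF assms(1,2)] unfolding cofinite_range_def by blast+

text \<open>The range has finite codimension, so it has a finite-dimensional complement, which is closed.\<close>

lemma drazin_finite_kernel_imp_Phi:
  assumes T: "T \<in> bounded_ops" "drazin T" "finite_dim (kernel T)"
  shows "T \<in> Phi_l" "T \<in> Phi_plus"
proof -
  have cof: "cofinite_range T" by (rule drazin_finite_kernel_cofinite_range[OF T])
  have cl: "closed (range T)" by (rule cofinite_range_finite_kernel(2)[OF T(1) drazin_resolvent_limit[OF T(1,2)] cof])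
  have nul: "nullity T < \<infinity>" using T(3) by (simp only: nullity_finite_iff)
  show "T \<in> Phi_plus" using T(1) cl nul by (simp add: Phi_plus_def)
  obtain F where F: "finite F" "complex_vector.span (range T \<union> F) = UNIV"
    using cof unfolding cofinite_range_def by blast
  obtain G where G: "finite G" "\<And>x. x \<in> range T \<Longrightarrow> x \<in> complex_vector.span G \<Longrightarrow> x = 0"
    "complex_vector.span (range T \<union> G) = complex_vector.span (range T \<union> F)"
    by (rule finite_complement[OF complex_subspace_range[OF T(1)] F(1)]) (rule that)
  note sub = complex_subspace_range[OF T(1)]
  have "range T \<inter> complex_vector.span G = {0}"
    using G(2) complex_vector.subspace_0[OF sub] complex_vector.span_zero by blast
  moreover have "{u + v |u v. u \<in> range T \<and> v \<in> complex_vector.span G} = UNIV"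
    using G(3) F(2) sub unfolding complex_vector.span_Un by (simp add: complex_vector.span_eq_iff[THEN iffD2])
  ultimately have "closed_complemented (range T)"
    unfolding closed_complemented_def using cl sub closed_span_finite[OF G(1)] complex_vector.subspace_span by blast
  thus "T \<in> Phi_l" using T(1) nul by (simp add: Phi_l_def)
qed

section \<open>Propagation over connected sets\<close>

lemma shift_shift: "shift_op (shift_op T l) m = shift_op T (l + m)"
  by (rule ext) (simp add: shift_op_def scaleC_add_left)

text \<open>The set where \<open>P\<close> holds is both open and closed in \<open>V\<close>.\<close>

lemma connected_propagation:
  fixes V :: "complex set"
  assumes V: "open V" "connected V" and l0: "l0 \<in> V" "P l0"
    and nbhd: "\<And>l. l \<in> V \<Longrightarrow> P l \<Longrightarrow> \<exists>d>0. \<forall>m. cmod m < d \<longrightarrow> P (l + m)"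
    and lim: "\<And>l. l \<in> V \<Longrightarrow> (\<And>e. e > 0 \<Longrightarrow> \<exists>m. cmod m < e \<and> P (l + m)) \<Longrightarrow> P l"
    and l: "l \<in> V"
  shows "P l"
proof (rule ccontr)
  assume "\<not> P l"
  have ball: "P u" if "\<forall>m. cmod m < d \<longrightarrow> P (v + m)" "u \<in> ball v d" for u v d
    using that(1)[rule_format, of "u - v"] that(2) by (simp add: dist_norm norm_minus_commute)
  have "open {l \<in> V. P l}"
    unfolding open_contains_ball
  proof (clarify)
    fix v assume v: "v \<in> V" "P v"
    obtain d where d: "d > 0" "\<forall>m. cmod m < d \<longrightarrow> P (v + m)" using nbhd[OF v] by blast
    obtain r where r: "r > 0" "ball v r \<subseteq> V" using V(1) v(1) open_contains_ball by blast
    have "ball v (min d r) \<subseteq> {l \<in> V. P l}" using ball[OF d(2)] r(2) by auto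
    thus "\<exists>e>0. ball v e \<subseteq> {l \<in> V. P l}" using d(1) r(1) by (intro exI[of _ "min d r"]) simp
  qed
  moreover have "open {l \<in> V. \<not> P l}"
    unfolding open_contains_ball
  proof (clarify)
    fix v assume v: "v \<in> V" "\<not> P v"
    obtain d where d: "d > 0" "\<forall>m. cmod m < d \<longrightarrow> \<not> P (v + m)" using lim[OF v(1)] v(2) by blast
    obtain r where r: "r > 0" "ball v r \<subseteq> V" using V(1) v(1) open_contains_ball by blast
    \<comment> \<open>By closedness, failure of \<open>P\<close> at \<open>v\<close> extends to a disc around \<open>v\<close>.\<close>
    have "\<not> P u" if "u \<in> ball v d" for u
      using d(2)[rule_format, of "u - v"] that by (simp add: dist_norm norm_minus_commute)
    hence "ball v (min d r) \<subseteq> {l \<in> V. \<not> P l}" using r(2) by auto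
    thus "\<exists>e>0. ball v e \<subseteq> {l \<in> V. \<not> P l}" using d(1) r(1) by (intro exI[of _ "min d r"]) simp
  qed
  moreover have "{l \<in> V. P l} \<inter> V \<noteq> {}" "{l \<in> V. \<not> P l} \<inter> V \<noteq> {}"
    using l0 l \<open>\<not> P l\<close> by auto
  ultimately show False
    using connectedD[OF V(2), of "{l \<in> V. P l}" "{l \<in> V. \<not> P l}"] by auto
qed

lemma drazin_shift_nbhd:
  assumes T: "T \<in> bounded_ops" and "drazin (shift_op T l)"
  obtains d where "d > 0" "\<And>m. m \<noteq> 0 \<Longrightarrow> cmod m < d \<Longrightarrow> bij (shift_op T (l + m))"
    "\<And>m. cmod m < d \<Longrightarrow> drazin (shift_op T (l + m))"
proof -
  obtain d where d: "d > 0" "\<And>m. m \<noteq> 0 \<Longrightarrow> cmod m < d \<Longrightarrow> bij (shift_op (shift_op T l) m)"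
    using drazin_punctured_disc[OF shift_bounded_ops[OF T] assms(2)] by metis
  show thesis
  proof (rule that[OF d(1)])
    show b: "bij (shift_op T (l + m))" if "m \<noteq> 0" "cmod m < d" for m
      using d(2)[OF that] by (simp add: shift_shift)
    show "drazin (shift_op T (l + m))" if "cmod m < d" for m
      using b[of m] that assms(2) bij_imp_drazin[OF shift_bounded_ops[OF T]] by (cases "m = 0") auto
  qed
qed

lemma small_nonzero:
  assumes "0 < (d::real)" obtains m :: complex where "m \<noteq> 0" "cmod m < d"
  by (rule that[of "of_real (d / 2)"]) (use assms in \<open>auto simp del: of_real_divide\<close>)

text \<open>Near a point where both operators are Drazin invertible, both are bijective on a common punctured
disc. The version with two operators is needed since the diagonal entries of a triangular operator
have to be inverted at the same points.\<close>

lemma drazin_pair_limit: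
  assumes A: "A \<in> bounded_ops" and B: "B \<in> bounded_ops" and e: "e > 0"
    and lim: "\<And>e. e > 0 \<Longrightarrow> \<exists>m. cmod m < e \<and> drazin (shift_op A (l + m)) \<and> drazin (shift_op B (l + m))"
  shows "\<exists>m. cmod m < e \<and> bij (shift_op (shift_op A l) m) \<and> bij (shift_op (shift_op B l) m)"
proof -
  obtain m where m: "cmod m < e / 2" "drazin (shift_op A (l + m))" "drazin (shift_op B (l + m))"
    using lim[of "e / 2"] e by auto
  obtain a where a: "a > 0" "\<And>h. h \<noteq> 0 \<Longrightarrow> cmod h < a \<Longrightarrow> bij (shift_op A (l + m + h))"
    by (rule drazin_shift_nbhd[OF A m(2)]) (rule that)
  obtain b where b: "b > 0" "\<And>h. h \<noteq> 0 \<Longrightarrow> cmod h < b \<Longrightarrow> bij (shift_op B (l + m + h))"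
    by (rule drazin_shift_nbhd[OF B m(3)]) (rule that)
  obtain h :: complex where h: "h \<noteq> 0" "cmod h < min (e / 2) (min a b)"
    by (rule small_nonzero[of "min (e / 2) (min a b)"]) (use e a(1) b(1) in auto)
  have "cmod (m + h) < e" using norm_triangle_ineq[of m h] m(1) h(2) by simp
  thus ?thesis
    using a(2)[OF h(1)] b(2)[OF h(1)] h(2)
    by (intro exI[of _ "m + h"]) (simp add: shift_shift add.assoc)
qed

text \<open>The open and closed conditions are the punctured disc of bijective points around a Drazin invertible
point, and the fact that an admissible limit of such points is Drazin invertible.\<close>

lemma drazin_propagates:
  assumes T: "T \<in> bounded_ops" and V: "open V" "connected V"
    and adm: "\<And>l. l \<in> V \<Longrightarrow> admissible (shift_op T l)"
    and l0: "l0 \<in> V" "bij (shift_op T l0)" and l: "l \<in> V"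
  shows "drazin (shift_op T l)"
proof (rule connected_propagation[OF V l0(1) _ _ _ l, where P = "\<lambda>l. drazin (shift_op T l)"])
  note S = shift_bounded_ops[OF T]
  show "drazin (shift_op T l0)" by (rule bij_imp_drazin[OF S l0(2)])
  show "\<exists>d>0. \<forall>m. cmod m < d \<longrightarrow> drazin (shift_op T (l + m))" if "drazin (shift_op T l)" for l
    by (rule drazin_shift_nbhd[OF T that]) blast
  fix l assume lV: "l \<in> V" and "\<And>e. e > 0 \<Longrightarrow> \<exists>m. cmod m < e \<and> drazin (shift_op T (l + m))"
  hence "resolvent_limit (shift_op T l)"
    unfolding resolvent_limit_def using drazin_pair_limit[OF T T] by metis
  thus "drazin (shift_op T l)" by (rule admissible_imp_drazin[OF S _ adm[OF lV]])
qed

text \<open>\<open>T - l\<close> is a perturbation of the bijection \<open>- l\<close>, with a constant that is small for large \<open>l\<close>.\<close>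

lemma bij_shift_outside_disc:
  assumes T: "T \<in> bounded_ops"
  shows "\<exists>R. \<forall>l. R < cmod l \<longrightarrow> bij (shift_op T l)"
proof -
  obtain K where K: "K > 0" "\<And>x. norm (T x) \<le> norm x * K"
    using bounded_linear.pos_bounded[OF bounded_opsD(1)[OF T]] by blast
  have "bij (shift_op T l)" if l: "2 * K < cmod l" for l
  proof (rule bounded_ops_bijI[OF shift_bounded_ops[OF T]])
    have l0: "l \<noteq> 0" using l K(1) by auto
    fix x assume "shift_op T l x = 0"
    hence "norm (T x) = cmod l * norm x" by (simp add: shift_op_def norm_scaleC)
    hence "cmod l * norm x \<le> K * norm x" using K(2)[of x] by (simp add: mult.commute)
    moreover have "K * norm x \<le> cmod l / 2 * norm x" using l by (intro mult_right_mono) auto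
    ultimately have "cmod l * norm x \<le> 0" by simp
    thus "x = 0" using l0 by (simp add: mult_le_0_iff)
  next
    fix y
    have l0: "l \<noteq> 0" using l K(1) by auto
    have "\<exists>x\<in>UNIV. (- l) *\<^sub>C x - (- T x) = y \<and> norm x \<le> 2 * inverse (cmod l) * norm y"
    proof (rule perturbed_surjection[OF bounded_linear_scaleC _ _ _ closed_UNIV subspace_UNIV subspace_UNIV])
      show "bounded_linear (\<lambda>x. - T x)" by (rule bounded_linear_minus[OF bounded_opsD(1)[OF T]])
      show "\<exists>x\<in>UNIV. (- l) *\<^sub>C x = y \<and> norm x \<le> inverse (cmod l) * norm y" for y
        using l0 by (intro bexI[of _ "(- inverse l) *\<^sub>C y"])
          (auto simp: norm_scaleC norm_inverse scaleC_scaleC scaleC_one)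
      show "norm (- T x) \<le> K * norm x" for x using K(2)[of x] by (simp add: mult.commute)
      show "K * inverse (cmod l) \<le> 1 / 2" using l l0 by (simp add: field_simps)
    qed (use K(1) in auto)
    thus "\<exists>x. shift_op T l x = y" by (auto simp: shift_op_def algebra_simps)
  qed
  thus ?thesis by blast
qed

section \<open>Triangular operators\<close>

lemma bounded_ops_fst: "(fst :: 'a::complex_banach \<times> 'b::complex_banach \<Rightarrow> 'a) \<in> bounded_ops"
  by (intro bounded_opsI bounded_linear_fst) (simp add: scaleC_prod_def)

lemma bounded_ops_snd: "(snd :: 'a::complex_banach \<times> 'b::complex_banach \<Rightarrow> 'b) \<in> bounded_ops"
  by (intro bounded_opsI bounded_linear_snd) (simp add: scaleC_prod_def)

lemma bounded_ops_inl: "(\<lambda>x :: 'a::complex_banach. (x, 0 :: 'b::complex_banach)) \<in> bounded_ops"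
  by (intro bounded_opsI bounded_linear_Pair bounded_linear_ident bounded_linear_zero) (simp add: scaleC_prod_def)

lemma bounded_ops_upper_triangular:
  assumes "A \<in> bounded_ops" "B \<in> bounded_ops" "C \<in> bounded_ops"
  shows "upper_triangular A C B \<in> bounded_ops"
proof (rule bounded_opsI)
  have eq: "upper_triangular A C B = (\<lambda>p. (A (fst p) + C (snd p), B (snd p)))"
    by (auto simp: upper_triangular_def)
  show "bounded_linear (upper_triangular A C B)"
    unfolding eq
    by (intro bounded_linear_Pair bounded_linear_add bounded_linear_compose[OF bounded_opsD(1)[OF assms(1)]]
        bounded_linear_compose[OF bounded_opsD(1)[OF assms(2)]]
        bounded_linear_compose[OF bounded_opsD(1)[OF assms(3)]] bounded_linear_fst bounded_linear_snd)
  show "upper_triangular A C B (c *\<^sub>C p) = c *\<^sub>C upper_triangular A C B p" for c p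
    by (cases p) (simp add: upper_triangular_def scaleC_prod_def scaleC_add_right
        bounded_opsD(2)[OF assms(1)] bounded_opsD(2)[OF assms(2)] bounded_opsD(2)[OF assms(3)])
qed

lemma shift_upper_triangular:
  "shift_op (upper_triangular A C B) l = upper_triangular (shift_op A l) C (shift_op B l)"
  by (rule ext) (auto simp: shift_op_def upper_triangular_def scaleC_prod_def)

locale triangular =
  fixes A :: "'x::complex_banach \<Rightarrow> 'x" and B :: "'y::complex_banach \<Rightarrow> 'y" and C :: "'y \<Rightarrow> 'x"
  assumes A: "A \<in> bounded_ops" and B: "B \<in> bounded_ops" and C: "C \<in> bounded_ops"
begin

abbreviation M :: "'x \<times> 'y \<Rightarrow> 'x \<times> 'y" where "M \<equiv> upper_triangular A C B"

lemma M: "M \<in> bounded_ops" by (rule bounded_ops_upper_triangular[OF A B C])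

lemma M_inl: "M (x, 0) = (A x, 0)"
  by (simp add: upper_triangular_def bounded_opsD(5)[OF B] bounded_opsD(5)[OF C])

lemma snd_M: "snd (M w) = B (snd w)"
  by (cases w) (simp add: upper_triangular_def)

lemma M_funpow_inl: "(M ^^ n) (x, 0) = ((A ^^ n) x, 0)"
  by (induction n) (auto simp: M_inl)

lemma snd_M_funpow: "snd ((M ^^ n) w) = (B ^^ n) (snd w)"
  by (induction n) (auto simp: snd_M)

text \<open>\<open>B\<close> acts on the second component of \<open>M\<close>, and \<open>A\<close> is the restriction of \<open>M\<close> to the vectors with
second component 0. The first \<open>p\<close> powers of \<open>M\<close> settle the second component, the next \<open>p\<close> the first;
hence the exponent \<open>p + p\<close>.\<close>

lemma drazin_triangular:
  assumes "drazin A" "drazin B" shows "drazin M"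
proof -
  obtain a b where "drazin_at A a" "drazin_at B b" using assms by (auto simp: drazin_def)
  \<comment> \<open>A common exponent exists by monotonicity.\<close>
  then obtain p where pA: "drazin_at A p" and pB: "drazin_at B p"
    using drazin_at_mono[OF A, of a "max a b"] drazin_at_mono[OF B, of b "max a b"] by auto
  note Mp = funpow_bounded_ops[OF M] and Ap = funpow_bounded_ops[OF A] and Bp = funpow_bounded_ops[OF B]
  have "kernel (M ^^ Suc (p + p)) \<subseteq> kernel (M ^^ (p + p))"
  proof
    fix w assume "w \<in> kernel (M ^^ Suc (p + p))"
    hence w: "(M ^^ (Suc p + p)) w = 0" by (simp add: kernel_def)
    have "(B ^^ (p + Suc p)) (snd w) = 0"
      using snd_M_funpow[of "Suc p + p" w] w by (simp add: add.commute)
    hence "(B ^^ p) (snd w) = 0" by (rule kernel_funpow_stable[OF drazin_atD(1)[OF pB]])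
    hence "snd ((M ^^ p) w) = 0" by (simp add: snd_M_funpow)
    then obtain x where x: "(M ^^ p) w = (x, 0)" by (metis prod.collapse)
    have "(A ^^ (p + 1)) x = 0"
      using w unfolding funpow_add_apply[of "Suc p" p] x M_funpow_inl by (simp add: zero_prod_def)
    hence "(A ^^ p) x = 0" by (rule kernel_funpow_stable[OF drazin_atD(1)[OF pA]])
    hence "(M ^^ (p + p)) w = 0"
      unfolding funpow_add_apply x M_funpow_inl by (simp add: zero_prod_def)
    thus "w \<in> kernel (M ^^ (p + p))" by (simp add: kernel_def)
  qed
  moreover have "range (M ^^ (p + p)) \<subseteq> range (M ^^ Suc (p + p))"
  proof
    fix u assume "u \<in> range (M ^^ (p + p))"
    then obtain w where w: "u = (M ^^ (p + p)) w" by blast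
    obtain y where y: "(B ^^ p) (snd w) = (B ^^ Suc p) y" using drazin_atD(2)[OF pB] by blast
    \<comment> \<open>Subtracting a vector of the range of \<open>M\<close> makes the second component vanish under \<open>B ^^ p\<close>.\<close>
    define v where "v = w - M (0, y)"
    have "(B ^^ p) (snd v) = 0"
      using y by (simp add: v_def snd_M bounded_opsD(4)[OF Bp] funpow_swap1)
    hence "snd ((M ^^ p) v) = 0" by (simp add: snd_M_funpow)
    then obtain x where x: "(M ^^ p) v = (x, 0)" by (metis prod.collapse)
    obtain x' where x': "(A ^^ p) x = (A ^^ (p + Suc p)) x'"
      using range_funpow_stable[OF drazin_atD(2)[OF pA]] by blast
    have "(M ^^ (p + p)) v = (M ^^ p) ((M ^^ p) v)" by (rule funpow_add_apply)
    also have "\<dots> = ((A ^^ p) x, 0)" unfolding x by (rule M_funpow_inl)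
    also have "\<dots> = ((A ^^ (p + Suc p)) x', 0)" by (simp only: x')
    also have "\<dots> = (M ^^ Suc (p + p)) (x', 0)" by (simp only: M_funpow_inl add_Suc_right)
    finally have "(M ^^ (p + p)) w = (M ^^ (p + p)) (M (0, y)) + (M ^^ Suc (p + p)) (x', 0)"
      by (simp only: v_def bounded_opsD(4)[OF Mp] diff_eq_eq add.commute)
    also have "(M ^^ (p + p)) (M (0, y)) = (M ^^ Suc (p + p)) (0, y)" by (simp only: funpow_Suc_right o_apply)
    finally have "u = (M ^^ Suc (p + p)) ((0, y) + (x', 0))"
      by (simp only: w bounded_opsD(3)[OF Mp])
    thus "u \<in> range (M ^^ Suc (p + p))" by blast
  qed
  ultimately have "drazin_at M (p + p)" by (simp only: drazin_at_def)
  thus ?thesis unfolding drazin_def by blast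
qed

text \<open>The restriction \<open>A\<close> inherits from \<open>M\<close> a lower bound on the range of \<open>A ^^ p\<close>, and the quotient \<open>B\<close>
inherits the stability of the ranges. The missing halves come from the limit hypothesis: by
\<open>drazin_if_bounded_below\<close> for \<open>A\<close>, and for \<open>B\<close> by lifting a kernel vector to the range of
\<open>M ^^ p\<close>, where \<open>M\<close> is onto, and letting it persist there.\<close>

lemma drazin_diagonal:
  assumes "drazin M"
    and lim: "\<And>e. e > 0 \<Longrightarrow> \<exists>m. cmod m < e \<and> bij (shift_op A m) \<and> bij (shift_op B m)"
  shows "drazin A" "drazin B"
proof -
  obtain p where p: "drazin_at M p" using assms(1) by (auto simp: drazin_def)
  have limA: "resolvent_limit A" using lim unfolding resolvent_limit_def by blast
  have "closed (range (M ^^ Suc p))"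
    by (rule drazin_closed_range[OF M drazin_at_mono[OF M p]]) simp
  then obtain c where c: "c > 0" "\<And>w. norm ((M ^^ p) w) \<le> c * norm ((M ^^ Suc p) w)"
    using finite_ascent_closed_range_bounded_below[OF M drazin_atD(1)[OF p]] by metis
  have "norm ((A ^^ p) x) \<le> c * norm ((A ^^ Suc p) x)" for x
    using c(2)[of "(x, 0)"] unfolding M_funpow_inl by (simp add: norm_prod_def)
  hence "drazin_at A p" by (rule drazin_if_bounded_below[OF A limA c(1)])
  thus "drazin A" unfolding drazin_def by blast
  define R where "R = range (M ^^ p)"
  have R: "closed R" "complex_vector.subspace R" "M ` R = R"
    unfolding R_def image_range_funpow
    using drazin_closed_range[OF M p] complex_subspace_range[OF funpow_bounded_ops[OF M]]
      drazin_atD(2)[OF p] range_funpow_antimono[of p "Suc p" M] by auto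
  obtain k where k: "k > 0"
    "\<forall>m. \<forall>y\<in>R. cmod m * k \<le> 1/2 \<longrightarrow> (\<exists>x\<in>R. shift_op M m x = y \<and> norm x \<le> 2 * k * norm y)"
    using shifted_surjection[OF M R] by blast
  have "kernel (B ^^ Suc p) \<subseteq> kernel (B ^^ p)"
  proof
    fix y assume "y \<in> kernel (B ^^ Suc p)"
    define v where "v = (B ^^ p) y"
    define w where "w = (M ^^ p) (0, y)"
    have Bv: "B v = 0" using \<open>y \<in> kernel (B ^^ Suc p)\<close> by (simp add: v_def kernel_def)
    have w: "w \<in> R" "snd w = v" by (auto simp: w_def v_def R_def snd_M_funpow)
    have "v = 0"
    proof (rule ccontr)
      assume "v \<noteq> 0"
      \<comment> \<open>The first bound permits the perturbation argument, the second makes the correction smaller than \<open>v\<close>.\<close>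
      define b where "b = min (1 / (2 * k)) (norm v / (2 * k * norm w + 1))"
      have pos: "2 * k * norm w + 1 > 0" using k(1) by (simp add: add_nonneg_pos)
      hence "b > 0" using k(1) \<open>v \<noteq> 0\<close> by (simp add: b_def)
      then obtain m where m: "cmod m < b" "bij (shift_op B m)" using lim by blast
      have mk: "cmod m * k \<le> 1/2" using m(1) k(1) by (simp add: b_def field_simps)
      have "m *\<^sub>C w \<in> R" using R(2) w(1) by (rule complex_vector.subspace_scale)
      then obtain w' where w': "shift_op M m w' = m *\<^sub>C w" "norm w' \<le> 2 * k * norm (m *\<^sub>C w)"
        using k(2) mk by blast
      have "snd (shift_op M m w') = m *\<^sub>C v" using w'(1) w(2) by (simp add: scaleC_prod_def)
      hence "shift_op B m (snd w') = m *\<^sub>C v" by (simp add: shift_op_def snd_M scaleC_prod_def)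
      moreover have "shift_op B m v = - (m *\<^sub>C v)" using Bv by (simp add: shift_op_def)
      ultimately have "shift_op B m (v + snd w') = 0"
        by (simp add: bounded_opsD(3)[OF shift_bounded_ops[OF B]])
      hence "v + snd w' = 0" by (rule bij_bounded_opsD[OF shift_bounded_ops[OF B] m(2)])
      hence "norm v = norm (snd w')" by (metis add_eq_0_iff norm_minus_cancel)
      also have "\<dots> \<le> norm w'" using norm_snd_le[of "snd w'" "fst w'"] by simp
      also have "\<dots> \<le> cmod m * (2 * k * norm w)" using w'(2) by (simp add: norm_scaleC mult_ac)
      also have "\<dots> \<le> cmod m * (2 * k * norm w + 1)" by (intro mult_left_mono) auto
      also have "\<dots> < norm v" using m(1) pos by (simp add: b_def pos_less_divide_eq)
      finally show False by simp
    qed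
    thus "y \<in> kernel (B ^^ p)" by (simp add: v_def kernel_def)
  qed
  moreover have "range (B ^^ p) \<subseteq> range (B ^^ Suc p)"
  proof
    fix u assume "u \<in> range (B ^^ p)"
    then obtain y where y: "u = (B ^^ p) y" by blast
    obtain w where "(M ^^ p) (0, y) = (M ^^ Suc p) w" using drazin_atD(2)[OF p] by blast
    hence "u = (B ^^ Suc p) (snd w)" unfolding y snd_M_funpow[symmetric] by (metis snd_M_funpow snd_conv)
    thus "u \<in> range (B ^^ Suc p)" by blast
  qed
  ultimately have "drazin_at B p" by (simp only: drazin_at_def)
  thus "drazin B" unfolding drazin_def by blast
qed

lemma bij_triangular:
  assumes "bij A" "bij B" shows "bij M"
proof (rule bounded_ops_bijI[OF M])
  fix w assume w: "M w = 0"
  hence "B (snd w) = 0" by (metis snd_M snd_zero)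
  hence s: "snd w = 0" by (rule bij_bounded_opsD[OF B assms(2)])
  hence "A (fst w) = 0" using w M_inl[of "fst w"] by (metis prod.collapse prod.inject zero_prod_def)
  hence "fst w = 0" by (rule bij_bounded_opsD[OF A assms(1)])
  thus "w = 0" using s by (simp add: prod_eq_iff)
next
  fix u :: "'x \<times> 'y"
  obtain y where y: "B y = snd u" using bij_is_surj[OF assms(2)] by (metis surjD)
  obtain x where x: "A x = fst u - C y" using bij_is_surj[OF assms(1)] by (metis surjD)
  have "M (x, y) = u" using x y by (simp add: upper_triangular_def)
  thus "\<exists>w. M w = u" ..
qed

lemma bij_diagonal:
  assumes "bij M" "drazin A" "drazin B" shows "bij A" "bij B"
proof -
  show "bij A"
  proof (rule drazin_injective_imp_bij[OF A assms(2)])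
    fix x assume "A x = 0"
    hence "M (x, 0) = 0" by (simp add: M_inl zero_prod_def)
    hence "(x, 0 :: 'y) = 0" by (rule bij_bounded_opsD[OF M assms(1)])
    thus "x = 0" by (simp add: zero_prod_def)
  qed
  have "\<exists>x. y = B x" for y
  proof -
    obtain w where "M w = (0, y)" using bij_is_surj[OF assms(1)] by (metis surjD)
    hence "y = B (snd w)" by (metis snd_M snd_conv)
    thus ?thesis ..
  qed
  thus "bij B" by (intro drazin_surjective_imp_bij[OF B assms(3)]) (simp add: surj_def)
qed

lemma finite_kernel_triangular:
  assumes "finite_dim (kernel A)" "finite_dim (kernel B)" shows "finite_dim (kernel M)"
proof (rule finite_dim_if_image_and_kernel[OF complex_subspace_kernel[OF M] bounded_ops_snd])
  have "snd ` kernel M \<subseteq> kernel B" by (auto simp: kernel_def upper_triangular_def zero_prod_def)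
  thus "finite_dim (snd ` kernel M)" by (rule finite_dim_subset[OF assms(2)])
  have "kernel M \<inter> kernel snd \<subseteq> (\<lambda>x. (x, 0)) ` kernel A"
    by (auto simp: kernel_def M_inl zero_prod_def)
  thus "finite_dim (kernel M \<inter> kernel snd)"
    by (rule finite_dim_subset[OF finite_dim_image[OF assms(1) bounded_ops_inl]])
qed

text \<open>The kernel of \<open>A\<close> embeds into that of \<open>M\<close>. For \<open>B\<close> only the codimension of the range is controlled
directly; a Drazin invertible \<open>B\<close> is a limit of bijective operators, so this bounds the kernel.\<close>

lemma finite_kernel_diagonal:
  assumes "drazin M" "finite_dim (kernel M)" "drazin B"
  shows "finite_dim (kernel A)" "finite_dim (kernel B)"
proof -
  have "kernel A \<subseteq> fst ` kernel M"
  proof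
    fix x assume "x \<in> kernel A"
    hence "(x, 0) \<in> kernel M" by (simp add: kernel_def M_inl zero_prod_def)
    thus "x \<in> fst ` kernel M" by (rule image_eqI[rotated]) simp
  qed
  thus "finite_dim (kernel A)"
    by (rule finite_dim_subset[OF finite_dim_image[OF assms(2) bounded_ops_fst]])
  obtain F where F: "finite F" "complex_vector.span (range M \<union> F) = UNIV"
    using drazin_finite_kernel_cofinite_range[OF M assms(1,2)] unfolding cofinite_range_def by blast
  have span: "complex_vector.span (snd ` (range M \<union> F)) = UNIV"
    unfolding complex_pair.linear_span_image[OF complex_linear[OF bounded_ops_snd]] F(2) by simp
  have "snd ` (range M \<union> F) \<subseteq> range B \<union> snd ` F" by (auto simp: snd_M)
  hence "complex_vector.span (snd ` (range M \<union> F)) \<subseteq> complex_vector.span (range B \<union> snd ` F)"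
    by (rule complex_vector.span_mono)
  hence "complex_vector.span (range B \<union> snd ` F) = UNIV" unfolding span by auto
  hence "cofinite_range B" unfolding cofinite_range_def using F(1) by blast
  thus "finite_dim (kernel B)"
    by (rule cofinite_range_finite_kernel(1)[OF B drazin_resolvent_limit[OF B assms(3)]])
qed

end

section \<open>Equality of the hulls\<close>

text \<open>The only facts about a class of operators that the comparison of hulls needs, besides its behaviour
on Drazin invertible operators.\<close>

definition spectral_class :: "(('a::complex_banach \<Rightarrow> 'a) \<Rightarrow> bool) \<Rightarrow> bool"
  where "spectral_class P \<longleftrightarrow>
    (\<forall>T\<in>bounded_ops. (P T \<longrightarrow> admissible T) \<and> (bij T \<longrightarrow> P T))"

text \<open>Take an open connected set \<open>V\<close> that contains a neighbourhood of infinity and misses one of the two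
spectral sets. It contains points where \<open>A\<close>, \<open>B\<close> and the triangular operator all have bijective
shifts. If it misses the spectrum of the triangular operator, Drazin invertibility propagates over
\<open>V\<close> first for that operator and then, jointly, for the diagonal entries; if it misses the spectra of
the diagonal entries, it propagates for each of them. The assumptions \<open>up\<close> and \<open>down\<close> then only have
to compare the classes on Drazin invertible operators.\<close>

lemma hull_eq_of_spectral_class:
  fixes A :: "'x::complex_banach \<Rightarrow> 'x" and B :: "'y::complex_banach \<Rightarrow> 'y"
  assumes ops: "A \<in> bounded_ops" "B \<in> bounded_ops" "C \<in> bounded_ops"
    and PA: "spectral_class PA" and PB: "spectral_class PB" and PM: "spectral_class PM"
    and up: "\<And>A B. \<lbrakk>triangular A B C; PA A; drazin A; PB B; drazin B\<rbrakk> \<Longrightarrow> PM (upper_triangular A C B)"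
    and down: "\<And>A B. \<lbrakk>triangular A B C; PM (upper_triangular A C B);
      drazin (upper_triangular A C B); drazin A; drazin B\<rbrakk> \<Longrightarrow> PA A \<and> PB B"
  shows "poly_hull ({l. \<not> PA (shift_op A l)} \<union> {l. \<not> PB (shift_op B l)})
    = poly_hull {l. \<not> PM (shift_op (upper_triangular A C B) l)}"
proof -
  define M where "M = upper_triangular A C B"
  have M: "M \<in> bounded_ops" unfolding M_def by (rule bounded_ops_upper_triangular[OF ops])
  have tri: "triangular (shift_op A l) (shift_op B l) C" for l
    by (intro triangular.intro shift_bounded_ops ops)
  have Ml: "shift_op M l = upper_triangular (shift_op A l) C (shift_op B l)" for l
    unfolding M_def by (rule shift_upper_triangular)
  obtain a b c where abc: "\<forall>l. a < cmod l \<longrightarrow> bij (shift_op A l)"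
    "\<forall>l. b < cmod l \<longrightarrow> bij (shift_op B l)" "\<forall>l. c < cmod l \<longrightarrow> bij (shift_op M l)"
    using bij_shift_outside_disc[OF ops(1)] bij_shift_outside_disc[OF ops(2)]
      bij_shift_outside_disc[OF M] by metis
  define R0 where "R0 = max 0 (max a (max b c))"
  have big: "bij (shift_op A l)" "bij (shift_op B l)" "bij (shift_op M l)" if "R0 < cmod l" for l
    using abc that by (auto simp: R0_def)
  have admA: "PA (shift_op A l) \<Longrightarrow> admissible (shift_op A l)" "bij (shift_op A l) \<Longrightarrow> PA (shift_op A l)" for l
    using PA shift_bounded_ops[OF ops(1)] unfolding spectral_class_def by blast+
  have admB: "PB (shift_op B l) \<Longrightarrow> admissible (shift_op B l)" "bij (shift_op B l) \<Longrightarrow> PB (shift_op B l)" for l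
    using PB shift_bounded_ops[OF ops(2)] unfolding spectral_class_def by blast+
  have admM: "PM (shift_op M l) \<Longrightarrow> admissible (shift_op M l)" "bij (shift_op M l) \<Longrightarrow> PM (shift_op M l)" for l
    using PM shift_bounded_ops[OF M] unfolding spectral_class_def by blast+
  let ?S1 = "{l. \<not> PA (shift_op A l)} \<union> {l. \<not> PB (shift_op B l)}" and ?S2 = "{l. \<not> PM (shift_op M l)}"
  have "l \<in> cball 0 R0" if "\<not> PA (shift_op A l) \<or> \<not> PB (shift_op B l) \<or> \<not> PM (shift_op M l)" for l
  proof (rule ccontr)
    assume "l \<notin> cball 0 R0"
    hence "R0 < cmod l" by simp
    thus False using that admA(2)[OF big(1)] admB(2)[OF big(2)] admM(2)[OF big(3)] by simp
  qed
  hence "?S1 \<subseteq> cball 0 R0" "?S2 \<subseteq> cball 0 R0" by blast+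
  hence bd: "bounded ?S1" "bounded ?S2" using bounded_cball bounded_subset by blast+
  have start: "\<exists>l0\<in>V. R0 < cmod l0" if "{z. R < cmod z} \<subseteq> V" for R V
  proof -
    define z :: complex where "z = of_real (max R R0 + 1)"
    have "cmod z = max R R0 + 1" unfolding z_def norm_of_real by (simp add: R0_def)
    thus ?thesis using that by (intro bexI[of _ z]) auto
  qed
  have "poly_hull ?S1 \<subseteq> poly_hull ?S2"
  proof (rule poly_hull_subset_if_outer[OF bd])
    fix V R assume V: "open V" "connected V" "V \<inter> ?S2 = {}" "{z. R < cmod z} \<subseteq> V"
    obtain l0 where l0: "l0 \<in> V" "R0 < cmod l0" using start[OF V(4)] by blast
    have PMV: "PM (shift_op M l)" if "l \<in> V" for l using V(3) that by blast
    have DM: "drazin (shift_op M l)" if "l \<in> V" for l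
      by (rule drazin_propagates[OF M V(1,2) admM(1)[OF PMV] l0(1) big(3)[OF l0(2)] that])
    have DAB: "drazin (shift_op A l) \<and> drazin (shift_op B l)" if "l \<in> V" for l
    proof (rule connected_propagation[OF V(1,2) l0(1) _ _ _ that,
          where P = "\<lambda>l. drazin (shift_op A l) \<and> drazin (shift_op B l)"])
      show "drazin (shift_op A l0) \<and> drazin (shift_op B l0)"
        by (intro conjI bij_imp_drazin shift_bounded_ops ops big[OF l0(2)])
      show "\<exists>d>0. \<forall>m. cmod m < d \<longrightarrow> drazin (shift_op A (l + m)) \<and> drazin (shift_op B (l + m))"
        if D: "drazin (shift_op A l) \<and> drazin (shift_op B l)" for l
      proof -
        obtain d where d: "d > 0" "\<And>m. cmod m < d \<Longrightarrow> drazin (shift_op A (l + m))"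
          by (rule drazin_shift_nbhd[OF ops(1) conjunct1[OF D]]) (rule that)
        obtain d' where d': "d' > 0" "\<And>m. cmod m < d' \<Longrightarrow> drazin (shift_op B (l + m))"
          by (rule drazin_shift_nbhd[OF ops(2) conjunct2[OF D]]) (rule that)
        show ?thesis using d d' by (intro exI[of _ "min d d'"]) auto
      qed
      fix l assume l: "l \<in> V" and lim: "\<And>e. e > 0 \<Longrightarrow>
        \<exists>m. cmod m < e \<and> drazin (shift_op A (l + m)) \<and> drazin (shift_op B (l + m))"
      have common: "\<exists>m. cmod m < e \<and> bij (shift_op (shift_op A l) m) \<and> bij (shift_op (shift_op B l) m)"
        if "e > 0" for e
        by (rule drazin_pair_limit[OF ops(1,2) that lim])
      show "drazin (shift_op A l) \<and> drazin (shift_op B l)"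
        using triangular.drazin_diagonal[OF tri DM[OF l, unfolded Ml] common] by simp
    qed
    have "PA (shift_op A l) \<and> PB (shift_op B l)" if "l \<in> V" for l
      by (rule down[OF tri PMV[OF that, unfolded Ml] DM[OF that, unfolded Ml]
            conjunct1[OF DAB[OF that]] conjunct2[OF DAB[OF that]]])
    thus "V \<inter> ?S1 = {}" by blast
  qed
  moreover have "poly_hull ?S2 \<subseteq> poly_hull ?S1"
  proof (rule poly_hull_subset_if_outer[OF bd(2,1)])
    fix V R assume V: "open V" "connected V" "V \<inter> ?S1 = {}" "{z. R < cmod z} \<subseteq> V"
    obtain l0 where l0: "l0 \<in> V" "R0 < cmod l0" using start[OF V(4)] by blast
    have PV: "PA (shift_op A l)" "PB (shift_op B l)" if "l \<in> V" for l using V(3) that by blast+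
    have DA: "drazin (shift_op A l)" if "l \<in> V" for l
      by (rule drazin_propagates[OF ops(1) V(1,2) admA(1)[OF PV(1)] l0(1) big(1)[OF l0(2)] that])
    have DB: "drazin (shift_op B l)" if "l \<in> V" for l
      by (rule drazin_propagates[OF ops(2) V(1,2) admB(1)[OF PV(2)] l0(1) big(2)[OF l0(2)] that])
    have "PM (shift_op M l)" if "l \<in> V" for l
      unfolding Ml by (rule up[OF tri PV(1)[OF that] DA[OF that] PV(2)[OF that] DB[OF that]])
    thus "V \<inter> ?S2 = {}" by blast
  qed
  ultimately show ?thesis unfolding M_def by blast
qed

lemma bij_imp_left_right_invertible:
  assumes T: "T \<in> bounded_ops" "bij T"
  shows "left_invertible T" "right_invertible T"
proof -
  have img: "range T = UNIV" by (rule bij_is_surj[OF T(2)])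
  obtain k where k: "k > 0" "\<And>y. y \<in> range T \<Longrightarrow> \<exists>x\<in>UNIV. T x = y \<and> norm x \<le> k * norm y"
    using open_mapping_bound[OF bounded_opsD(1)[OF T(1)] closed_UNIV subspace_UNIV] img by (metis closed_UNIV)
  define S where "S = inv T"
  have TS: "T (S y) = y" and ST: "S (T x) = x" for x y
    unfolding S_def using T(2) by (auto simp: bij_is_surj surj_f_inv_f bij_is_inj inv_f_f)
  have injT: "T x = T y \<Longrightarrow> x = y" for x y by (metis ST)
  have Sc: "S (c *\<^sub>C y) = c *\<^sub>C S y" for c y by (rule injT) (simp add: bounded_opsD(2)[OF T(1)] TS)
  have "S \<in> bounded_ops"
  proof (rule bounded_opsI[OF bounded_linear_intro Sc])
    show "S (x + y) = S x + S y" for x y by (rule injT) (simp add: bounded_opsD(3)[OF T(1)] TS)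
    show "S (r *\<^sub>R x) = r *\<^sub>R S x" for r x by (simp add: scaleR_scaleC Sc)
    show "norm (S x) \<le> norm x * k" for x
    proof -
      obtain u where "T u = x" "norm u \<le> k * norm x" using k(2) img by blast
      thus ?thesis using ST by (auto simp: mult.commute)
    qed
  qed
  moreover have "S \<circ> T = id" "T \<circ> S = id" using TS ST by auto
  ultimately show "left_invertible T" "right_invertible T"
    unfolding left_invertible_def right_invertible_def by blast+
qed

text \<open>With a left inverse \<open>S\<close>, the range of \<open>T\<close> is the set of fixed points of the continuous map \<open>T \<circ> S\<close>.\<close>

lemma left_invertible_imp:
  assumes T: "T \<in> bounded_ops" and "left_invertible T"
  shows "T x = 0 \<Longrightarrow> x = 0" "finite_dim (kernel T)" "closed (range T)"
proof -
  obtain S where S: "S \<in> bounded_ops" "S \<circ> T = id" using assms(2) by (auto simp: left_invertible_def)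
  have ST: "S (T x) = x" for x using S(2) by (metis comp_apply id_apply)
  show inj: "x = 0" if "T x = 0" for x using ST[of x] that by (simp add: bounded_opsD(5)[OF S(1)])
  hence "kernel T \<subseteq> complex_vector.span {}" by (auto simp: kernel_def)
  thus "finite_dim (kernel T)" unfolding finite_dim_def by blast
  have "range T = {y. T (S y) = y}" using ST by (auto intro: range_eqI[OF sym]) 
  also have "closed \<dots>"
    by (intro closed_Collect_eq continuous_on_id linear_continuous_on
        bounded_linear_compose[OF bounded_opsD(1)[OF T] bounded_opsD(1)[OF S(1)]])
  finally show "closed (range T)" .
qed

lemma right_invertible_imp_surj: "right_invertible T \<Longrightarrow> surj T"
  unfolding right_invertible_def by (metis comp_apply id_apply surjI)

lemma surj_imp_cofinite_range: "surj T \<Longrightarrow> cofinite_range T"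
  unfolding cofinite_range_def by (intro exI[of _ "{}"]) simp

lemma bij_imp_Phi_plus:
  assumes T: "T \<in> bounded_ops" "bij T"
  shows "T \<in> Phi_plus" "nullity T = 0"
proof -
  show n: "nullity T = 0" unfolding nullity_eq_0_iff[OF T(1)] using bij_bounded_opsD[OF T] by blast
  have "nullity T < \<infinity>" unfolding n by simp
  thus "T \<in> Phi_plus" using T by (simp add: Phi_plus_def bij_is_surj)
qed

lemma Phi_union_admissible:
  assumes "T \<in> Phi_plus \<union> Phi_minus \<or> T \<in> Phi_l \<union> Phi_r"
  shows "finite_dim (kernel T) \<and> closed (range T) \<or> cofinite_range T"
  using assms finite_deficiency_cofinite_range
  unfolding Phi_plus_def Phi_minus_def Phi_l_def Phi_r_def nullity_finite_iff closed_complemented_def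
    mem_Collect_eq Un_iff
  by metis

lemma Phi_union_drazin_finite_kernel:
  assumes "T \<in> bounded_ops" "drazin T" "T \<in> Phi_plus \<union> Phi_minus \<or> T \<in> Phi_l \<union> Phi_r"
  shows "finite_dim (kernel T)"
  using Phi_union_admissible[OF assms(3)]
    cofinite_range_finite_kernel(1)[OF assms(1) drazin_resolvent_limit[OF assms(1,2)]] by blast

text \<open>Ascent and descent of a Drazin invertible operator are 0 together, so one-sided bijectivity suffices.\<close>

lemma SF0_drazin_iff:
  assumes T: "T \<in> bounded_ops" "drazin T" shows "T \<in> SF0 \<longleftrightarrow> bij T"
proof
  assume "T \<in> SF0"
  hence "nullity T = 0 \<or> deficiency T = 0" by (simp add: SF0_def)
  thus "bij T"
    using drazin_injective_imp_bij[OF T] drazin_surjective_imp_bij[OF T] deficiency_0_surj[OF T(1)]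
      nullity_eq_0_iff[OF T(1)] by blast
next
  assume "bij T"
  thus "T \<in> SF0" using bij_imp_Phi_plus[OF T(1)] by (simp add: SF0_def)
qed

lemma left_or_right_invertible_drazin_iff:
  assumes T: "T \<in> bounded_ops" "drazin T"
  shows "left_invertible T \<or> right_invertible T \<longleftrightarrow> bij T"
  using drazin_injective_imp_bij[OF T] drazin_surjective_imp_bij[OF T] left_invertible_imp(1)[OF T(1)]
    right_invertible_imp_surj bij_imp_left_right_invertible[OF T(1)] by blast

lemma Phi_union_drazin_iff:
  assumes T: "T \<in> bounded_ops" "drazin T"
  shows "T \<in> Phi_plus \<union> Phi_minus \<longleftrightarrow> finite_dim (kernel T)"
    "T \<in> Phi_l \<union> Phi_r \<longleftrightarrow> finite_dim (kernel T)"
  using Phi_union_drazin_finite_kernel[OF T] drazin_finite_kernel_imp_Phi[OF T] by blast+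

lemma bij_finite_kernel: "(T :: 'a::complex_banach \<Rightarrow> 'a) \<in> bounded_ops \<Longrightarrow> bij T \<Longrightarrow> finite_dim (kernel T)"
  unfolding nullity_finite_iff[symmetric] by (simp add: bij_imp_Phi_plus(2))

lemma spectral_classI:
  assumes "\<And>T. T \<in> bounded_ops \<Longrightarrow> P T \<Longrightarrow> admissible T"
    and "\<And>T. T \<in> bounded_ops \<Longrightarrow> bij T \<Longrightarrow> P T"
  shows "spectral_class P"
  using assms by (simp add: spectral_class_def)

lemma spectral_class_R9: "spectral_class (\<lambda>T. T \<in> R9)"
  by (rule spectral_classI) (simp_all add: admissible_def drazin_imp_R9 bij_imp_drazin)

lemma spectral_class_R4: "spectral_class (\<lambda>T. T \<in> R4)"
  by (rule spectral_classI) (simp_all add: admissible_def drazin_imp_R4 bij_imp_drazin)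

lemma spectral_class_left_or_right_invertible:
  "spectral_class (\<lambda>T. left_invertible T \<or> right_invertible T)"
proof (rule spectral_classI)
  fix T :: "'a \<Rightarrow> 'a" assume T: "T \<in> bounded_ops"
  show "left_invertible T \<or> right_invertible T" if "bij T"
    using bij_imp_left_right_invertible(1)[OF T that] ..
  assume "left_invertible T \<or> right_invertible T"
  thus "admissible T"
  proof
    assume "left_invertible T"
    from left_invertible_imp(2,3)[OF T this] show ?thesis by (simp add: admissible_def)
  next
    assume "right_invertible T"
    hence "cofinite_range T" by (intro surj_imp_cofinite_range right_invertible_imp_surj)
    thus ?thesis by (simp add: admissible_def)
  qed
qed

lemma spectral_class_SF0: "spectral_class (\<lambda>T. T \<in> SF0)"
proof (rule spectral_classI)
  fix T :: "'a \<Rightarrow> 'a" assume T: "T \<in> bounded_ops"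
  show "T \<in> SF0" if "bij T" using SF0_drazin_iff[OF T bij_imp_drazin[OF T that]] that by simp
  assume "T \<in> SF0"
  hence "T \<in> Phi_plus \<union> Phi_minus \<or> T \<in> Phi_l \<union> Phi_r" by (simp add: SF0_def)
  from Phi_union_admissible[OF this] show "admissible T" by (auto simp: admissible_def)
qed

lemma spectral_class_Phi:
  "spectral_class (\<lambda>T :: 'a::complex_banach \<Rightarrow> 'a. T \<in> Phi_plus \<union> Phi_minus)"
  "spectral_class (\<lambda>T :: 'a \<Rightarrow> 'a. T \<in> Phi_l \<union> Phi_r)"
proof -
  have adm: "admissible T" if "T \<in> Phi_plus \<union> Phi_minus \<or> T \<in> Phi_l \<union> Phi_r"
    for T :: "'a \<Rightarrow> 'a"
    using Phi_union_admissible[OF that] by (auto simp: admissible_def)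
  have bij: "T \<in> Phi_plus \<union> Phi_minus \<and> T \<in> Phi_l \<union> Phi_r" if T: "T \<in> bounded_ops" "bij T"
    for T :: "'a \<Rightarrow> 'a"
    using Phi_union_drazin_iff[OF T(1) bij_imp_drazin[OF T]] bij_finite_kernel[OF T] by blast
  show "spectral_class (\<lambda>T :: 'a \<Rightarrow> 'a. T \<in> Phi_plus \<union> Phi_minus)"
    by (rule spectral_classI) (use adm bij in blast)+
  show "spectral_class (\<lambda>T :: 'a \<Rightarrow> 'a. T \<in> Phi_l \<union> Phi_r)"
    by (rule spectral_classI) (use adm bij in blast)+
qed

text \<open>The case of classes that, among Drazin invertible operators, consist of the invertible ones.\<close>

lemma hull_eq_of_invertible_class:
  fixes A :: "'x::complex_banach \<Rightarrow> 'x" and B :: "'y::complex_banach \<Rightarrow> 'y"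
  assumes ops: "A \<in> bounded_ops" "B \<in> bounded_ops" "C \<in> bounded_ops"
    and P: "spectral_class PA" "spectral_class PB" "spectral_class PM"
    and PA: "\<And>T. \<lbrakk>T \<in> bounded_ops; drazin T\<rbrakk> \<Longrightarrow> PA T \<longleftrightarrow> bij T"
    and PB: "\<And>T. \<lbrakk>T \<in> bounded_ops; drazin T\<rbrakk> \<Longrightarrow> PB T \<longleftrightarrow> bij T"
    and PM: "\<And>T. \<lbrakk>T \<in> bounded_ops; drazin T\<rbrakk> \<Longrightarrow> PM T \<longleftrightarrow> bij T"
  shows "poly_hull ({l. \<not> PA (shift_op A l)} \<union> {l. \<not> PB (shift_op B l)})
    = poly_hull {l. \<not> PM (shift_op (upper_triangular A C B) l)}"
proof (rule hull_eq_of_spectral_class[OF ops P])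
  fix A :: "'x \<Rightarrow> 'x" and B :: "'y \<Rightarrow> 'y"
  assume "triangular A B C"
  then interpret triangular A B C .
  assume D: "drazin A" "drazin B"
  show "PM M" if "PA A" "PB B"
    using that D bij_triangular drazin_triangular by (simp add: PA[OF A] PB[OF B] PM[OF M])
  show "PA A \<and> PB B" if "PM M" "drazin M"
    using that D bij_diagonal by (simp add: PA[OF A] PB[OF B] PM[OF M])
qed

text \<open>The case of classes that, among Drazin invertible operators, consist of those with
finite-dimensional kernel (the Browder operators).\<close>

lemma hull_eq_of_Fredholm_class:
  fixes A :: "'x::complex_banach \<Rightarrow> 'x" and B :: "'y::complex_banach \<Rightarrow> 'y"
  assumes ops: "A \<in> bounded_ops" "B \<in> bounded_ops" "C \<in> bounded_ops"
    and P: "spectral_class PA" "spectral_class PB" "spectral_class PM"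
    and PA: "\<And>T. \<lbrakk>T \<in> bounded_ops; drazin T\<rbrakk> \<Longrightarrow> PA T \<longleftrightarrow> finite_dim (kernel T)"
    and PB: "\<And>T. \<lbrakk>T \<in> bounded_ops; drazin T\<rbrakk> \<Longrightarrow> PB T \<longleftrightarrow> finite_dim (kernel T)"
    and PM: "\<And>T. \<lbrakk>T \<in> bounded_ops; drazin T\<rbrakk> \<Longrightarrow> PM T \<longleftrightarrow> finite_dim (kernel T)"
  shows "poly_hull ({l. \<not> PA (shift_op A l)} \<union> {l. \<not> PB (shift_op B l)})
    = poly_hull {l. \<not> PM (shift_op (upper_triangular A C B) l)}"
proof (rule hull_eq_of_spectral_class[OF ops P])
  fix A :: "'x \<Rightarrow> 'x" and B :: "'y \<Rightarrow> 'y"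
  assume "triangular A B C"
  then interpret triangular A B C .
  assume D: "drazin A" "drazin B"
  show "PM M" if "PA A" "PB B"
    using that D finite_kernel_triangular drazin_triangular by (simp add: PA[OF A] PB[OF B] PM[OF M])
  show "PA A \<and> PB B" if "PM M" "drazin M"
    using that D finite_kernel_diagonal by (simp add: PA[OF A] PB[OF B] PM[OF M])
qed

theorem theorem4p5:
  fixes A :: "'x::complex_banach \<Rightarrow> 'x"
    and B :: "'y::complex_banach \<Rightarrow> 'y"
    and C :: "'y \<Rightarrow> 'x"
  assumes "edim (UNIV :: 'x set) = \<infinity>"
    and "edim (UNIV :: 'y set) = \<infinity>"
    and "A \<in> bounded_ops" and "B \<in> bounded_ops" and "C \<in> bounded_ops"
  shows "poly_hull (sigma_lD A \<union> sigma_lD B) = poly_hull (sigma_lD (upper_triangular A C B))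
    \<and> poly_hull (sigma_rD A \<union> sigma_rD B) = poly_hull (sigma_rD (upper_triangular A C B))
    \<and> poly_hull (sigma_lr A \<union> sigma_lr B) = poly_hull (sigma_lr (upper_triangular A C B))
    \<and> poly_hull (sigma_K3 A \<union> sigma_K3 B) = poly_hull (sigma_K3 (upper_triangular A C B))
    \<and> poly_hull (sigma_K A \<union> sigma_K B) = poly_hull (sigma_K (upper_triangular A C B))
    \<and> poly_hull (sigma_SF0 A \<union> sigma_SF0 B) = poly_hull (sigma_SF0 (upper_triangular A C B))"
proof (intro conjI)
  note ops = assms(3-5)
  show "poly_hull (sigma_lD A \<union> sigma_lD B) = poly_hull (sigma_lD (upper_triangular A C B))"
    unfolding sigma_lD_def
    by (rule hull_eq_of_spectral_class[OF ops spectral_class_R9 spectral_class_R9 spectral_class_R9])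
      (simp_all add: drazin_imp_R9 triangular.A triangular.B triangular.M triangular.drazin_triangular)
  show "poly_hull (sigma_rD A \<union> sigma_rD B) = poly_hull (sigma_rD (upper_triangular A C B))"
    unfolding sigma_rD_def
    by (rule hull_eq_of_spectral_class[OF ops spectral_class_R4 spectral_class_R4 spectral_class_R4])
      (simp_all add: drazin_imp_R4 triangular.A triangular.B triangular.M triangular.drazin_triangular)
  show "poly_hull (sigma_lr A \<union> sigma_lr B) = poly_hull (sigma_lr (upper_triangular A C B))"
    unfolding sigma_lr_def de_Morgan_disj[symmetric]
    by (rule hull_eq_of_invertible_class[OF ops spectral_class_left_or_right_invertible
          spectral_class_left_or_right_invertible spectral_class_left_or_right_invertible
          left_or_right_invertible_drazin_iff left_or_right_invertible_drazin_iff
          left_or_right_invertible_drazin_iff])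
  show "poly_hull (sigma_SF0 A \<union> sigma_SF0 B) = poly_hull (sigma_SF0 (upper_triangular A C B))"
    unfolding sigma_SF0_def
    by (rule hull_eq_of_invertible_class[OF ops spectral_class_SF0 spectral_class_SF0 spectral_class_SF0
          SF0_drazin_iff SF0_drazin_iff SF0_drazin_iff])
  show "poly_hull (sigma_K A \<union> sigma_K B) = poly_hull (sigma_K (upper_triangular A C B))"
    unfolding sigma_K_def
    by (rule hull_eq_of_Fredholm_class[OF ops spectral_class_Phi(1) spectral_class_Phi(1) spectral_class_Phi(1)
          Phi_union_drazin_iff(1) Phi_union_drazin_iff(1) Phi_union_drazin_iff(1)])
  show "poly_hull (sigma_K3 A \<union> sigma_K3 B) = poly_hull (sigma_K3 (upper_triangular A C B))"
    unfolding sigma_K3_def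
    by (rule hull_eq_of_Fredholm_class[OF ops spectral_class_Phi(2) spectral_class_Phi(2) spectral_class_Phi(2)
          Phi_union_drazin_iff(2) Phi_union_drazin_iff(2) Phi_union_drazin_iff(2)])
qed

end
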